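(* For all integers $1\le d\le n$ there exists a set $G\subset\mathbb{Z}^2$ with $|G|=n$ such that the discrete line disjointness function $\mathrm{Disj}_G|_{\mathcal{L}\times\mathcal{L}}$ satisfies $$D(\mathrm{Disj}_G|_{\mathcal{L}\times\mathcal{L}})=\Theta\left(d\log\tfrac{n}{d}\right),\qquad D^{\rightarrow}(\mathrm{Disj}_G|_{\mathcal{L}\times\mathcal{L}})=\Theta\left(d\log\tfrac{n}{d}\right),$$ and, in the randomized setting, $$R(\mathrm{Disj}_G|_{\mathcal{L}\times\mathcal{L}})=\Omega\left(d\,\frac{\log(n/d)}{\log\log(n/d)}\right).$$
   Context: Communication complexity: for a function $f:\Omega_1\times\Omega_2\to\Omega$, Alice receives $x\in\Omega_1$, Bob receives $y\in\Omega_2$, and they exchange bits to compute $f(x,y)$. $D(f)$ is the minimum over deterministic protocols of the worst-case number of bits exchanged (any number of rounds). In the randomized setting Alice and Bob share an infinite public random string and on every input the output must be correct with probability at least $2/3$; $R(f)$ is the minimum worst-case number of bits exchanged by such a protocol. $D^{\rightarrow}(f)$ is the one-way deterministic version: only Alice sends a message to Bob, and Bob computes the output. Discrete line disjointness: $L$ is the set of all lines in $\mathbb{R}^2$ and $\mathcal{L}$ is the collection of all $d$-element subsets of $L$. For a finite $G\subset\mathbb{Z}^2$, the function $\mathrm{Disj}_G|_{\mathcal{L}\times\mathcal{L}}:\mathcal{L}\times\mathcal{L}\to\{0,1\}$ takes $(\{\ell_1,\dots,\ell_d\},\{\ell'_1,\dots,\ell'_d\})$ to $1$ if $\ell_i\cap\ell'_j\cap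 G=\emptyset$ for all $i,j\in[d]$, and to $0$ otherwise. The set $G$ is known to both players. Asymptotic notation: the constants implied in $O,\Omega,\Theta$ are absolute (independent of $n$ and $d$), and the bounds are asserted whenever $n/d$ is at least some absolute constant. *)

theory Defs
  imports "HOL-Probability.Probability" "HOL-Library.Extended_Real"
begin

text \<open>
  A deterministic two-party protocol is a finite binary tree. At an inner node the owner of the
  node announces one bit, a function of her or his own input; \<open>True\<close> selects the second subtree.
  A leaf carries the output. The history of the conversation is encoded by the position in the tree.
\<close>

datatype ('a, 'b, 'c) protocol =
    Output 'c
  | Alice "'a \<Rightarrow> bool" "('a, 'b, 'c) protocol" "('a, 'b, 'c) protocol"
  | Bob "'b \<Rightarrow> bool" "('a, 'b, 'c) protocol" "('a, 'b, 'c) protocol"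

primrec run :: "('a, 'b, 'c) protocol \<Rightarrow> 'a \<Rightarrow> 'b \<Rightarrow> 'c" where
  "run (Output z) x y = z"
| "run (Alice a p q) x y = (if a x then run q x y else run p x y)"
| "run (Bob b p q) x y = (if b y then run q x y else run p x y)"

primrec num_bits :: "('a, 'b, 'c) protocol \<Rightarrow> 'a \<Rightarrow> 'b \<Rightarrow> nat" where
  "num_bits (Output z) x y = 0"
| "num_bits (Alice a p q) x y = Suc (if a x then num_bits q x y else num_bits p x y)"
| "num_bits (Bob b p q) x y = Suc (if b y then num_bits q x y else num_bits p x y)"

text \<open>
  The complexity measures below are for the function \<open>f\<close> restricted to \<open>X \<times> Y\<close>. They take values in
  \<^typ>\<open>enat\<close>, being infinite if and only if no protocol of bounded cost exists.
\<close>

definition det_cc :: "'a set \<Rightarrow> 'b set \<Rightarrow> ('a \<Rightarrow> 'b \<Rightarrow> 'c) \<Rightarrow> enat" where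
  "det_cc X Y f =
     (INF p \<in> {p :: ('a, 'b, 'c) protocol. \<forall>x\<in>X. \<forall>y\<in>Y. run p x y = f x y}.
        SUP x\<in>X. SUP y\<in>Y. enat (num_bits p x y))"

text \<open>
  In a one-way protocol the end of the message must be recognisable; messages of at most \<open>k\<close> bits
  forming a prefix-free code can be padded, so all messages are taken to have exactly \<open>k\<close> bits.
\<close>

definition oneway_cc :: "'a set \<Rightarrow> 'b set \<Rightarrow> ('a \<Rightarrow> 'b \<Rightarrow> 'c) \<Rightarrow> enat" where
  "oneway_cc X Y f =
     (INF k \<in> {k :: nat. \<exists>(msg :: 'a \<Rightarrow> bool list) (out :: bool list \<Rightarrow> 'b \<Rightarrow> 'c).
                 (\<forall>x\<in>X. length (msg x) = k) \<and> (\<forall>x\<in>X. \<forall>y\<in>Y. out (msg x) y = f x y)}.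
        enat k)"

definition coins :: "(nat \<Rightarrow> bool) measure" where
  "coins = (\<Pi>\<^sub>M i\<in>UNIV. measure_pmf (bernoulli_pmf (1/2)))"

text \<open>
  A public-coin protocol assigns to every random string \<open>r\<close> a deterministic protocol \<open>P r\<close>.
\<close>

definition rand_computes ::
  "'a set \<Rightarrow> 'b set \<Rightarrow> ('a \<Rightarrow> 'b \<Rightarrow> 'c) \<Rightarrow> ((nat \<Rightarrow> bool) \<Rightarrow> ('a, 'b, 'c) protocol) \<Rightarrow> bool" where
  "rand_computes X Y f P \<longleftrightarrow>
     (\<forall>x\<in>X. \<forall>y\<in>Y. {r \<in> space coins. run (P r) x y = f x y} \<in> sets coins \<and>
                  measure coins {r \<in> space coins. run (P r) x y = f x y} \<ge> 2/3)"

definition rand_cc :: "'a set \<Rightarrow> 'b set \<Rightarrow> ('a \<Rightarrow> 'b \<Rightarrow> 'c) \<Rightarrow> enat" where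
  "rand_cc X Y f =
     (INF P \<in> {P. rand_computes X Y f P}.
        SUP r. SUP x\<in>X. SUP y\<in>Y. enat (num_bits (P r) x y))"

definition lines :: "(real \<times> real) set set" where
  "lines = {l. affine l \<and> aff_dim l = 1}"

definition line_families :: "nat \<Rightarrow> (real \<times> real) set set set" where
  "line_families d = {S. S \<subseteq> lines \<and> finite S \<and> card S = d}"

text \<open>The values 1 and 0 of the disjointness function are \<open>True\<close> and \<open>False\<close>.\<close>

definition line_disj ::
  "(real \<times> real) set \<Rightarrow> (real \<times> real) set set \<Rightarrow> (real \<times> real) set set \<Rightarrow> bool" where
  "line_disj G S T \<longleftrightarrow> (\<forall>l\<in>S. \<forall>l'\<in>T. l \<inter> l' \<inter> G = {})"

end

theory Submission
  imports Defs
begin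

text \<open>
  Put \<open>k \<approx> log\<^sub>4 (n/d)\<close> and split a disjointness instance on \<open>d k\<close> points into \<open>d\<close> blocks of size \<open>k\<close>.
  Alice encodes the \<open>b\<close>-th block \<open>Z\<close> of her set by a vertical line indexed by \<open>(b, Z)\<close>, Bob encodes
  his block \<open>W\<close> by a horizontal line indexed by \<open>(b, W)\<close>, and \<open>G\<close> contains the crossing of the two lines
  iff \<open>Z \<inter> W \<noteq> {}\<close>. This takes at most \<open>d 4\<^sup>k \<le> n\<close> points, and set disjointness on \<open>d k\<close> points,
  whose randomized complexity is linear, becomes a restriction of the line problem.
  With exponentially growing vertical coordinates, a line that is neither vertical nor horizontal
  meets the grid in at most two points. Hence \<open>\<Union>S \<inter> G\<close>, which determines the row of
  Alice's input \<open>S\<close>, is a union of at most \<open>2 d\<close> out of \<open>O(n)\<close> sets, and sending it takes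
  \<open>O(d log (n/d))\<close> bits.

  Set disjointness is bounded below by a corruption argument. Choose a coordinate \<open>i\<close> and a random
  partition of the others into \<open>D\<close> and its complement; Alice's set is random below \<open>D\<close>, Bob's below
  the complement, and \<open>i\<close> is added to both sets or to neither. On a rectangle \<open>A \<times> B\<close> the intersecting
  variant is at least \<open>16/25\<close> times as likely as the disjoint one, except for pairs \<open>(i, D)\<close>
  where membership of \<open>i\<close> is biased within \<open>A\<close> or within \<open>B\<close>; a family that is biased in
  many coordinates is exponentially small. As \<open>2/3 - 25/16 * 1/3 > 0\<close>, no amplification of
  the error \<open>1/3\<close> is needed.
\<close>

subsection \<open>Families with many biased coordinates are small\<close>

lemma sum_Pow_prod:
  fixes f :: "'a \<Rightarrow> 'b::comm_semiring_1"
  assumes "finite E"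
  shows "(\<Sum>X\<in>Pow E. \<Prod>i\<in>X. f i) = (\<Prod>i\<in>E. 1 + f i)"
  using assms
proof (induction E)
  case empty
  then show ?case by simp
next
  case (insert e E)
  have *: "(\<Prod>i\<in>insert e X. f i) = f e * (\<Prod>i\<in>X. f i)" if "X \<in> Pow E" for X
    using insert.hyps that finite_subset[of X E] by (subst prod.insert) auto
  have "(\<Sum>X\<in>Pow (insert e E). \<Prod>i\<in>X. f i)
      = (\<Sum>X\<in>Pow E. \<Prod>i\<in>X. f i) + (\<Sum>X\<in>insert e ` Pow E. \<Prod>i\<in>X. f i)"
    unfolding Pow_insert using insert.hyps by (intro sum.union_disjoint) auto
  also have "(\<Sum>X\<in>insert e ` Pow E. \<Prod>i\<in>X. f i) = (\<Sum>X\<in>Pow E. \<Prod>i\<in>insert e X. f i)"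
    using insert.hyps by (subst sum.reindex) (auto simp: inj_on_def)
  also have "\<dots> = f e * (\<Sum>X\<in>Pow E. \<Prod>i\<in>X. f i)"
    by (simp add: * sum_distrib_left)
  finally show ?case
    using insert by (simp add: algebra_simps)
qed

lemma sum_Pow_power_card:
  fixes t :: "'b::comm_semiring_1"
  assumes "finite E"
  shows "(\<Sum>X\<in>Pow E. t ^ card X) = (1 + t) ^ card E"
  using sum_Pow_prod[OF assms, of "\<lambda>_. t"] by simp

text \<open>As \<open>t \<le> 1\<close>, each counted set has weight \<open>t ^ card X\<close> at
  least \<open>t ^ r\<close>. At \<open>t = d / n\<close> this later counts unions of few
  atoms.\<close>

lemma card_subsets_le_bound:
  fixes t :: real
  assumes "finite E" "0 < t" "t \<le> 1"
  shows "real (card {X. X \<subseteq> E \<and> card X \<le> r}) * t ^ r \<le> (1 + t) ^ card E"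
proof -
  have "real (card {X. X \<subseteq> E \<and> card X \<le> r}) * t ^ r = (\<Sum>X\<in>{X. X \<subseteq> E \<and> card X \<le> r}. t ^ r)"
    by simp
  also have "\<dots> \<le> (\<Sum>X\<in>{X. X \<subseteq> E \<and> card X \<le> r}. t ^ card X)"
    using assms by (intro sum_mono power_decreasing) auto
  also have "\<dots> \<le> (\<Sum>X\<in>Pow E. t ^ card X)"
    using assms by (intro sum_mono2) auto
  finally show ?thesis using sum_Pow_power_card[OF assms(1), of t] by simp
qed

text \<open>Loss per biased coordinate in the moment bound at \<open>t = 4/5\<close>:
  \<open>9/10\<close> is \<open>(1 + t) / 2\<close>, and \<open>(5/4) powr (4/9)\<close> is
  \<open>t powr (- 4/9)\<close>, where \<open>4/9\<close> bounds the frequency of a biased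
  coordinate.\<close>

definition bias_rate :: real where
  "bias_rate = 9/10 * (5/4) powr (4/9)"

lemma bias_rate_pos: "0 < bias_rate"
  by (simp add: bias_rate_def)

lemma bias_rate_less_1: "bias_rate < 1"
proof -
  \<comment> \<open>The ninth power clears the fractional exponent and leaves a comparison of
    rationals.\<close>
  have "((5/4) powr (4/9)) ^ 9 = ((5/4::real) powr (4/9)) powr (real 9)"
    by (subst powr_realpow) auto
  also have "\<dots> = (5/4) powr (real 4)"
    by (simp add: powr_powr)
  also have "\<dots> = (5/4) ^ 4"
    by (subst powr_realpow) auto
  finally have "bias_rate ^ 9 = (9/10) ^ 9 * (5/4) ^ 4"
    unfolding bias_rate_def power_mult_distrib by simp
  also have "\<dots> < 1" by (simp add: eval_nat_numeral)
  finally show ?thesis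
    using power_less_one_iff[of bias_rate 9] bias_rate_pos by simp
qed

text \<open>Only scarcity of \<open>i\<close> counts, because what must be controlled is the weight
  lost by adding \<open>i\<close>. For finite \<open>A\<close> the test says that \<open>i\<close>
  lies in fewer than \<open>4/9\<close> of the members.\<close>

definition biased :: "'a set set \<Rightarrow> 'a set \<Rightarrow> 'a set" where
  "biased A E = {i\<in>E. 5 * card {X\<in>A. i \<in> X} < 4 * card {X\<in>A. i \<notin> X}}"

text \<open>Exponential moment \<open>\<Sum>X\<in>A. t ^ card (X \<inter> biased A E)\<close> at \<open>t = 4/5\<close>: it is at most the same
  sum over \<open>Pow E\<close>, and at least \<open>card A\<close> times \<open>t\<close> to the average exponent, by Jensen.\<close>

lemma card_family_le_biased:
  assumes "finite E" "A \<subseteq> Pow E"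
  shows "real (card A) \<le> 2 ^ card E * bias_rate ^ card (biased A E)"
proof -
  define I where "I = biased A E"
  define s where "s = card I"
  define t :: real where "t = 4/5"
  define m where "m = 4 * real s / 9"
  have finA: "finite A" using assms finite_subset by blast
  have IE: "I \<subseteq> E" and finI: "finite I"
    using assms(1) by (auto simp: I_def biased_def)
  have "(\<Sum>X\<in>A. card (X \<inter> I)) = (\<Sum>X\<in>A. \<Sum>i\<in>I. if i \<in> X then 1 else 0)"
    using finI by (simp add: sum.If_cases Int_commute)
  also have "\<dots> = (\<Sum>i\<in>I. \<Sum>X\<in>A. if i \<in> X then 1 else 0)"
    by (rule sum.swap)
  also have "\<dots> = (\<Sum>i\<in>I. card {X\<in>A. i \<in> X})"
    using finA by (intro sum.cong refl) (simp add: sum.If_cases Int_def)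
  finally have swap: "(\<Sum>X\<in>A. card (X \<inter> I)) = (\<Sum>i\<in>I. card {X\<in>A. i \<in> X})" .
  have "9 * card {X\<in>A. i \<in> X} \<le> 4 * card A" if "i \<in> I" for i
  proof -
    have "card A = card {X\<in>A. i \<in> X} + card {X\<in>A. i \<notin> X}"
      using finA by (subst card_Un_disjoint[symmetric]) (auto intro!: arg_cong[where f = card])
    then show ?thesis using that by (simp add: I_def biased_def)
  qed
  then have "9 * (\<Sum>i\<in>I. card {X\<in>A. i \<in> X}) \<le> (\<Sum>i\<in>I. 4 * card A)"
    unfolding sum_distrib_left by (rule sum_mono)
  then have avg_nat: "9 * (\<Sum>X\<in>A. card (X \<inter> I)) \<le> 4 * s * card A"
    by (simp add: swap s_def)
  have "real (9 * (\<Sum>X\<in>A. card (X \<inter> I))) \<le> real (4 * s * card A)"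
    using avg_nat of_nat_le_iff by blast
  then have avg: "(\<Sum>X\<in>A. real (card (X \<inter> I))) \<le> m * card A"
    by (simp add: m_def field_simps)
  \<comment> \<open>Both \<open>ln t\<close> and the difference next to it are nonpositive, so the
    added term is nonnegative.\<close>
  have "t powr m * card A \<le> t powr m * (card A + ln t * ((\<Sum>X\<in>A. real (card (X \<inter> I))) - m * card A))"
    using avg by (intro mult_left_mono) (auto simp: t_def intro: mult_nonpos_nonpos)
  also have "\<dots> = (\<Sum>X\<in>A. t powr m * (1 + (real (card (X \<inter> I)) - m) * ln t))"
    unfolding sum_distrib_left[symmetric]
    by (simp add: sum.distrib sum_subtractf algebra_simps sum_distrib_left sum_distrib_right)
  also have "\<dots> \<le> (\<Sum>X\<in>A. t ^ card (X \<inter> I))"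
  proof (rule sum_mono)
    fix X
    \<comment> \<open>The tangent at exponent \<open>m\<close> lies below the convex function; this
      is the Jensen step.\<close>
    have "t powr m * (1 + (real (card (X \<inter> I)) - m) * ln t)
        \<le> t powr m * exp ((real (card (X \<inter> I)) - m) * ln t)"
      using exp_ge_add_one_self by (intro mult_left_mono) auto
    also have "\<dots> = t powr (real (card (X \<inter> I)))"
      by (simp add: powr_def t_def exp_add[symmetric] algebra_simps)
    finally show "t powr m * (1 + (real (card (X \<inter> I)) - m) * ln t) \<le> t ^ card (X \<inter> I)"
      by (simp add: powr_realpow t_def)
  qed
  also have "\<dots> \<le> (\<Sum>X\<in>Pow E. t ^ card (X \<inter> I))"
    using assms by (intro sum_mono2) (auto simp: t_def)
  also have "\<dots> = (\<Sum>X\<in>Pow E. \<Prod>i\<in>X. if i \<in> I then t else 1)"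
    using assms(1) by (intro sum.cong) (auto simp: prod.If_cases finite_subset)
  also have "\<dots> = (\<Prod>i\<in>E. 1 + (if i \<in> I then t else 1))"
    by (rule sum_Pow_prod) fact
  also have "\<dots> = (\<Prod>i\<in>E. if i \<in> I then 1 + t else 2)"
    by (intro prod.cong) auto
  also have "\<dots> = (1 + t) ^ s * 2 ^ (card E - s)"
    using assms(1) IE by (simp add: prod.If_cases s_def Int_absorb1 Diff_eq[symmetric] card_Diff_subset finite_subset)
  also have "\<dots> = 2 ^ card E * (9/10) ^ s"
    using card_mono[OF assms(1) IE] by (simp add: s_def t_def power_diff power_divide field_simps power_mult_distrib flip: power_mult_distrib)
  finally have "t powr m * card A \<le> 2 ^ card E * (9/10) ^ s" .
  then have "(t powr m * card A) * (5/4) powr m \<le> 2 ^ card E * (9/10) ^ s * (5/4) powr m"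
    by (intro mult_right_mono) auto
  moreover have "t powr m * (5/4) powr m = 1"
    unfolding t_def by (subst powr_mult[symmetric]) auto
  then have "(t powr m * card A) * (5/4) powr m = card A"
    by (metis mult.commute mult.left_commute mult_1)
  moreover have "bias_rate ^ s = (9/10) ^ s * (5/4) powr m"
  proof -
    have "((5/4 :: real) powr (4/9)) ^ s = ((5/4) powr (4/9)) powr real s"
      by (subst powr_realpow) auto
    then show ?thesis
      unfolding bias_rate_def power_mult_distrib by (simp add: powr_powr m_def)
  qed
  ultimately have "real (card A) \<le> 2 ^ card E * bias_rate ^ s"
    by (simp only: mult.assoc)
  then show ?thesis by (simp only: s_def I_def)
qed

subsection \<open>Corruption of rectangles by intersecting pairs\<close>

text \<open>Unnormalised expectations of \<open>F\<close>: over pairs that are disjoint and avoid \<open>i\<close>, over pairs meeting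
  exactly in \<open>i\<close>, and over disjoint pairs separated by \<open>D\<close>. The last one has total mass
  \<open>4 ^ card U\<close>, the other two \<open>card U * 4 ^ (card U - 1)\<close>.\<close>

definition weight0 :: "'a set \<Rightarrow> ('a set \<Rightarrow> 'a set \<Rightarrow> real) \<Rightarrow> real" where
  "weight0 U F = (\<Sum>i\<in>U. \<Sum>D\<in>Pow (U - {i}). \<Sum>x\<in>Pow D. \<Sum>y\<in>Pow (U - {i} - D). F x y)"

definition weight1 :: "'a set \<Rightarrow> ('a set \<Rightarrow> 'a set \<Rightarrow> real) \<Rightarrow> real" where
  "weight1 U F =
     (\<Sum>i\<in>U. \<Sum>D\<in>Pow (U - {i}). \<Sum>x\<in>Pow D. \<Sum>y\<in>Pow (U - {i} - D). F (insert i x) (insert i y))"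

definition weight :: "'a set \<Rightarrow> ('a set \<Rightarrow> 'a set \<Rightarrow> real) \<Rightarrow> real" where
  "weight U F = (\<Sum>D\<in>Pow U. \<Sum>x\<in>Pow D. \<Sum>y\<in>Pow (U - D). F x y)"

lemma sum_Pow_complement:
  "(\<Sum>D\<in>Pow E. f (E - D)) = (\<Sum>D\<in>Pow E. f D)"
  by (rule sum.reindex_bij_witness[of _ "\<lambda>D. E - D" "\<lambda>D. E - D"]) auto

text \<open>Pairs \<open>(i, D)\<close> with \<open>i\<close> outside \<open>D\<close> correspond to
  pairs \<open>(E, i)\<close> with \<open>i\<close> in \<open>E = insert i D\<close>. Summing over
  \<open>i\<close> inside lets the biased coordinates of one fixed \<open>E\<close> be
  counted.\<close>

lemma sum_Pow_insert:
  fixes h :: "'a \<Rightarrow> 'a set \<Rightarrow> 'b::comm_monoid_add"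
  assumes "finite U"
  shows "(\<Sum>i\<in>U. \<Sum>D\<in>Pow (U - {i}). h i (insert i D)) = (\<Sum>E\<in>Pow U. \<Sum>i\<in>E. h i E)"
proof -
  have fin: "finite E" if "E \<subseteq> U" for E
    using that assms finite_subset by blast
  have "(\<Sum>i\<in>U. \<Sum>D\<in>Pow (U - {i}). h i (insert i D))
      = (\<Sum>(i, D)\<in>Sigma U (\<lambda>i. Pow (U - {i})). h i (insert i D))"
    using assms by (subst sum.Sigma) auto
  also have "\<dots> = (\<Sum>(E, i)\<in>Sigma (Pow U) (\<lambda>E. E). h i E)"
    by (rule sum.reindex_bij_witness[of _ "\<lambda>(E, i). (i, E - {i})" "\<lambda>(i, D). (insert i D, i)"])
       (auto simp: insert_absorb)
  also have "\<dots> = (\<Sum>E\<in>Pow U. \<Sum>i\<in>E. h i E)"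
    using assms fin by (subst sum.Sigma) auto
  finally show ?thesis .
qed

definition below :: "'a set set \<Rightarrow> 'a set \<Rightarrow> nat" where
  "below A D = card (A \<inter> Pow D)"

definition below_insert :: "'a set set \<Rightarrow> 'a \<Rightarrow> 'a set \<Rightarrow> nat" where
  "below_insert A i D = card {X\<in>Pow D. insert i X \<in> A}"

lemma below_le: "finite D \<Longrightarrow> real (below A D) \<le> 2 ^ card D"
  using card_mono[of "Pow D" "A \<inter> Pow D"] by (simp add: below_def card_Pow numeral_power_le_of_nat_cancel_iff)

lemma sum_rectangle:
  assumes "finite P" "finite Q"
  shows "(\<Sum>x\<in>P. \<Sum>y\<in>Q. of_bool (x \<in> A \<and> y \<in> B)) = real (card (A \<inter> P) * card (B \<inter> Q))"
proof -
  have "(\<Sum>x\<in>P. \<Sum>y\<in>Q. of_bool (x \<in> A \<and> y \<in> B)) = (\<Sum>x\<in>P. of_bool (x \<in> A)) * (\<Sum>y\<in>Q. of_bool (y \<in> B) :: real)"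
    by (simp add: sum_product of_bool_conj)
  then show ?thesis using assms by (simp add: Int_commute sum.If_cases Int_def)
qed

text \<open>With \<open>E = insert i D\<close>, a pair contributes only if \<open>i\<close> is
  biased in the part of \<open>A\<close> below \<open>E\<close>. If at most
  \<open>\<delta> * card U\<close> coordinates are biased there, the first term pays; otherwise that
  part of \<open>A\<close> is exponentially small and the second term pays.\<close>

lemma biased_contribution:
  fixes \<delta> :: real
  assumes U: "finite U" "0 < \<delta>"
  shows "(\<Sum>i\<in>U. \<Sum>D\<in>Pow (U - {i}). of_bool (5 * below_insert A i D < 4 * below A D) *
             (real (below A D) * real (below B (U - {i} - D))))
         \<le> \<delta> * card U * (\<Sum>D\<in>Pow U. real (below A D) * real (below B (U - D)))
            + card U * bias_rate powr (\<delta> * card U) * 4 ^ card U"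
proof -
  define n where "n = card U"
  \<comment> \<open>Using \<open>below A E\<close> in place of \<open>below A D\<close> gives all
    \<open>i\<close> in \<open>E\<close> the same factor, so summing over \<open>i\<close> just
    counts biased coordinates.\<close>
  define h where "h i E = of_bool (i \<in> biased (A \<inter> Pow E) E) * (real (below A E) * real (below B (U - E)))" for i E
  have term_le: "of_bool (5 * below_insert A i D < 4 * below A D) *
      (real (below A D) * real (below B (U - {i} - D))) \<le> h i (insert i D)"
    if i: "i \<in> U" and D: "D \<in> Pow (U - {i})" for i D
  proof -
    have fD: "finite D" and iD: "i \<notin> D" using D U finite_subset by blast+
    have eq: "{X\<in>A \<inter> Pow (insert i D). i \<in> X} = insert i ` {X\<in>Pow D. insert i X \<in> A}"
    proof (intro equalityI subsetI)
      fix X assume "X \<in> {X\<in>A \<inter> Pow (insert i D). i \<in> X}"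
      then have "X = insert i (X - {i})" "X - {i} \<in> {X\<in>Pow D. insert i X \<in> A}"
        by (auto simp: insert_absorb)
      then show "X \<in> insert i ` {X\<in>Pow D. insert i X \<in> A}" by blast
    qed auto
    have "inj_on (insert i) {X\<in>Pow D. insert i X \<in> A}"
      using iD by (auto simp: inj_on_def)
    then have p1: "card {X\<in>A \<inter> Pow (insert i D). i \<in> X} = below_insert A i D"
      unfolding eq below_insert_def by (rule card_image)
    have p0: "{X\<in>A \<inter> Pow (insert i D). i \<notin> X} = A \<inter> Pow D"
      using iD by auto
    have bad: "5 * below_insert A i D < 4 * below A D \<longleftrightarrow> i \<in> biased (A \<inter> Pow (insert i D)) (insert i D)"
      by (simp only: biased_def mem_Collect_eq p1 p0 below_def insert_iff simp_thms)
    have "below A D \<le> below A (insert i D)"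
      unfolding below_def using fD by (intro card_mono) auto
    moreover have "U - {i} - D = U - insert i D" by auto
    ultimately show ?thesis
      unfolding bad h_def by (intro mult_left_mono mult_mono) auto
  qed
  have E_le: "(\<Sum>i\<in>E. h i E) \<le> \<delta> * n * (real (below A E) * real (below B (U - E)))
      + n * bias_rate powr (\<delta> * n) * 2 ^ n" if E: "E \<in> Pow U" for E
  proof -
    define s where "s = card (biased (A \<inter> Pow E) E)"
    have fE: "finite E" using E U finite_subset by blast
    have "card E \<le> n" using E U by (auto simp: n_def intro: card_mono)
    have bE: "biased (A \<inter> Pow E) E \<subseteq> E" by (auto simp: biased_def)
    then have "s \<le> card E" unfolding s_def using fE by (rule card_mono[rotated])
    then have sn: "s \<le> n" using \<open>card E \<le> n\<close> by simp
    have sum_h: "(\<Sum>i\<in>E. h i E) = real s * (real (below A E) * real (below B (U - E)))"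
      using fE bE by (simp add: h_def s_def sum.If_cases Int_absorb1 flip: sum_distrib_right)
    show ?thesis
    proof (cases "real s \<le> \<delta> * n")
      case True
      then have "(\<Sum>i\<in>E. h i E) \<le> \<delta> * n * (real (below A E) * real (below B (U - E)))"
        unfolding sum_h by (intro mult_right_mono) auto
      then show ?thesis by (simp add: add_increasing2)
    next
      case False
      have "real (below A E) \<le> 2 ^ card E * bias_rate ^ s"
        unfolding below_def s_def by (rule card_family_le_biased[OF fE]) auto
      also have "bias_rate ^ s = bias_rate powr s"
        by (simp add: powr_realpow bias_rate_pos)
      also have "\<dots> \<le> bias_rate powr (\<delta> * n)"
        using False bias_rate_less_1 bias_rate_pos by (intro powr_mono') auto
      finally have a: "real (below A E) \<le> 2 ^ card E * bias_rate powr (\<delta> * n)" by simp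
      have b: "real (below B (U - E)) \<le> 2 ^ card (U - E)"
        using U by (intro below_le) auto
      have "(\<Sum>i\<in>E. h i E) \<le> n * ((2 ^ card E * bias_rate powr (\<delta> * n)) * 2 ^ card (U - E))"
        unfolding sum_h using sn a b by (intro mult_mono) auto
      also have "\<dots> = n * bias_rate powr (\<delta> * n) * 2 ^ (card E + card (U - E))"
        by (simp add: power_add)
      also have "card E + card (U - E) = n"
        using E U fE \<open>card E \<le> n\<close> by (simp add: card_Diff_subset n_def)
      finally show ?thesis using U by (simp add: add_increasing)
    qed
  qed
  have "(\<Sum>i\<in>U. \<Sum>D\<in>Pow (U - {i}). of_bool (5 * below_insert A i D < 4 * below A D) *
             (real (below A D) * real (below B (U - {i} - D))))
      \<le> (\<Sum>i\<in>U. \<Sum>D\<in>Pow (U - {i}). h i (insert i D))"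
    by (intro sum_mono term_le)
  also have "\<dots> = (\<Sum>E\<in>Pow U. \<Sum>i\<in>E. h i E)"
    by (rule sum_Pow_insert) fact
  also have "\<dots> \<le> (\<Sum>E\<in>Pow U. \<delta> * n * (real (below A E) * real (below B (U - E)))
      + n * bias_rate powr (\<delta> * n) * 2 ^ n)"
    by (intro sum_mono E_le)
  also have "\<dots> = \<delta> * n * (\<Sum>D\<in>Pow U. real (below A D) * real (below B (U - D)))
            + n * bias_rate powr (\<delta> * n) * 4 ^ n"
    using U by (simp add: sum.distrib sum_distrib_left card_Pow n_def power_mult_distrib[symmetric] algebra_simps)
  finally show ?thesis by (simp add: n_def)
qed

text \<open>The constant \<open>25/16\<close> is \<open>(5/4)\<^sup>2\<close>: for a pair \<open>(i, D)\<close> biased on neither side, adding \<open>i\<close>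
  costs a factor of at most \<open>4/5\<close> on each side.\<close>

lemma rectangle_corruption:
  fixes \<delta> :: real
  assumes U: "finite U" "0 < \<delta>"
  shows "weight0 U (\<lambda>x y. of_bool (x \<in> A \<and> y \<in> B)) - 25/16 * weight1 U (\<lambda>x y. of_bool (x \<in> A \<and> y \<in> B))
      - 2 * \<delta> * card U * weight U (\<lambda>x y. of_bool (x \<in> A \<and> y \<in> B))
      \<le> 2 * card U * bias_rate powr (\<delta> * card U) * 4 ^ card U"
proof -
  define p0 where "p0 i D = real (below A D)" for i :: 'a and D
  define p1 where "p1 i D = real (below_insert A i D)" for i D
  define q0 where "q0 i D = real (below B (U - {i} - D))" for i D
  define q1 where "q1 i D = real (below_insert B i (U - {i} - D))" for i D
  let ?bA = "\<lambda>i D. of_bool (5 * below_insert A i D < 4 * below A D) :: real"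
  let ?bB = "\<lambda>i D. of_bool (5 * below_insert B i (U - {i} - D) < 4 * below B (U - {i} - D)) :: real"
  let ?R = "\<lambda>x y. of_bool (x \<in> A \<and> y \<in> B) :: real"
  have fin: "finite D" if "D \<in> Pow (U - {i})" for i D
    using that U finite_subset by blast
  have w0: "weight0 U ?R = (\<Sum>i\<in>U. \<Sum>D\<in>Pow (U - {i}). p0 i D * q0 i D)"
    unfolding weight0_def p0_def q0_def below_def using U fin
    by (intro sum.cong refl) (subst sum_rectangle, auto)
  have w1: "weight1 U ?R = (\<Sum>i\<in>U. \<Sum>D\<in>Pow (U - {i}). p1 i D * q1 i D)"
    unfolding weight1_def
  proof (intro sum.cong refl)
    fix i D assume D: "D \<in> Pow (U - {i})"
    have "(\<Sum>x\<in>Pow D. \<Sum>y\<in>Pow (U - {i} - D). ?R (insert i x) (insert i y))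
       = (\<Sum>x\<in>Pow D. \<Sum>y\<in>Pow (U - {i} - D). of_bool (x \<in> {x. insert i x \<in> A} \<and> y \<in> {y. insert i y \<in> B}))"
      by simp
    also have "\<dots> = p1 i D * q1 i D"
      using fin[OF D] U by (subst sum_rectangle) (auto simp: p1_def q1_def below_insert_def Int_def conj_commute)
    finally show "(\<Sum>x\<in>Pow D. \<Sum>y\<in>Pow (U - {i} - D). ?R (insert i x) (insert i y)) = p1 i D * q1 i D" .
  qed
  have w: "weight U ?R = (\<Sum>D\<in>Pow U. real (below A D) * real (below B (U - D)))"
    unfolding weight_def below_def using U
    by (intro sum.cong refl) (subst sum_rectangle, auto intro: finite_subset)
  \<comment> \<open>If a side is biased, its indicator term alone covers the left-hand side.\<close>
  have pointwise: "p0 i D * q0 i D \<le> 25/16 * (p1 i D * q1 i D) + ?bA i D * (p0 i D * q0 i D) + ?bB i D * (p0 i D * q0 i D)" for i D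
  proof (cases "5 * below_insert A i D < 4 * below A D \<or> 5 * below_insert B i (U - {i} - D) < 4 * below B (U - {i} - D)")
    case True
    have "0 \<le> p0 i D * q0 i D" "0 \<le> p1 i D * q1 i D"
      by (simp_all add: p0_def q0_def p1_def q1_def)
    then show ?thesis using True by auto
  next
    case False
    then have "4/5 * p0 i D \<le> p1 i D" "4/5 * q0 i D \<le> q1 i D"
      by (simp_all add: p0_def q0_def p1_def q1_def)
    then have "(4/5 * p0 i D) * (4/5 * q0 i D) \<le> p1 i D * q1 i D"
      by (intro mult_mono) (auto simp: p0_def q0_def p1_def)
    then show ?thesis using False by simp
  qed
  have "weight0 U ?R \<le> (\<Sum>i\<in>U. \<Sum>D\<in>Pow (U - {i}). 25/16 * (p1 i D * q1 i D) + ?bA i D * (p0 i D * q0 i D) + ?bB i D * (p0 i D * q0 i D))"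
    unfolding w0 by (intro sum_mono pointwise)
  also have "\<dots> = 25/16 * weight1 U ?R + (\<Sum>i\<in>U. \<Sum>D\<in>Pow (U - {i}). ?bA i D * (p0 i D * q0 i D))
      + (\<Sum>i\<in>U. \<Sum>D\<in>Pow (U - {i}). ?bB i D * (p0 i D * q0 i D))"
    unfolding w1 by (simp only: sum.distrib sum_distrib_left)
  also have "(\<Sum>i\<in>U. \<Sum>D\<in>Pow (U - {i}). ?bA i D * (p0 i D * q0 i D))
      \<le> \<delta> * card U * weight U ?R + card U * bias_rate powr (\<delta> * card U) * 4 ^ card U"
    unfolding w p0_def q0_def by (rule biased_contribution[OF U])
  \<comment> \<open>Replacing \<open>D\<close> by its complement in \<open>U - {i}\<close> exchanges
    the players, so the estimate for Alice's side applies to Bob's.\<close>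
  also have "(\<Sum>i\<in>U. \<Sum>D\<in>Pow (U - {i}). ?bB i D * (p0 i D * q0 i D))
      = (\<Sum>i\<in>U. \<Sum>D\<in>Pow (U - {i}). of_bool (5 * below_insert B i D < 4 * below B D) *
             (real (below B D) * real (below A (U - {i} - D))))"
    unfolding p0_def q0_def
  proof (rule sum.cong[OF refl])
    fix i
    let ?g = "\<lambda>D. of_bool (5 * below_insert B i D < 4 * below B D) *
             (real (below B D) * real (below A (U - {i} - D)))"
    have "(\<Sum>D\<in>Pow (U - {i}). ?g D) = (\<Sum>D\<in>Pow (U - {i}). ?g (U - {i} - D))"
      by (rule sum_Pow_complement[symmetric])
    also have "\<dots> = (\<Sum>D\<in>Pow (U - {i}). ?bB i D * (real (below A D) * real (below B (U - {i} - D))))"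
      by (intro sum.cong refl) (simp add: double_diff mult.commute)
    finally show "(\<Sum>D\<in>Pow (U - {i}). ?bB i D * (real (below A D) * real (below B (U - {i} - D))))
       = (\<Sum>D\<in>Pow (U - {i}). ?g D)" ..
  qed
  also have "\<dots> \<le> \<delta> * card U * (\<Sum>D\<in>Pow U. real (below B D) * real (below A (U - D)))
        + card U * bias_rate powr (\<delta> * card U) * 4 ^ card U"
    by (rule biased_contribution[OF U])
  also have "(\<Sum>D\<in>Pow U. real (below B D) * real (below A (U - D))) = weight U ?R"
    unfolding w by (subst (2) sum_Pow_complement[symmetric])
      (intro sum.cong refl, auto simp: double_diff)
  finally show ?thesis by (simp add: algebra_simps)
qed

subsection \<open>Randomized set disjointness\<close>

text \<open>The inputs reaching a leaf form a rectangle, and at most \<open>2 ^ c\<close> leaves are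
  reached, so additivity reduces an output class to rectangles. The induction cuts \<open>A\<close>
  at Alice's nodes and \<open>B\<close> at Bob's.\<close>

lemma protocol_rectangles:
  fixes \<Phi> :: "('a \<Rightarrow> 'b \<Rightarrow> real) \<Rightarrow> real"
  assumes add: "\<And>F G. \<Phi> (\<lambda>x y. F x y + G x y) = \<Phi> F + \<Phi> G"
    and rect: "\<And>A B. \<Phi> (\<lambda>x y. of_bool (x \<in> A \<and> y \<in> B)) \<le> \<kappa>"
    and bits: "\<And>x y. x \<in> A \<Longrightarrow> y \<in> B \<Longrightarrow> num_bits p x y \<le> c"
  shows "\<Phi> (\<lambda>x y. of_bool (x \<in> A \<and> y \<in> B \<and> run p x y = z)) \<le> 2 ^ c * \<kappa>"
proof -
  have zero: "\<Phi> (\<lambda>x y. 0) = 0"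
    using add[of "\<lambda>x y. 0" "\<lambda>x y. 0"] by simp
  \<comment> \<open>Nonnegativity lets a leaf reached early, or one with another output, be charged
    \<open>2 ^ c * \<kappa>\<close>.\<close>
  have "0 \<le> \<kappa>" using rect[of "{}" "{}"] zero by simp
  then have grow: "\<kappa> \<le> 2 ^ c * \<kappa>" "0 \<le> 2 ^ c * \<kappa>" for c
    using mult_right_mono[of 1 "2 ^ c" \<kappa>] by simp_all
  show ?thesis using bits
  proof (induction p arbitrary: A B c)
    case (Output w)
    show ?case
    proof (cases "w = z")
      case True
      then show ?thesis using order.trans[OF rect[of A B] grow(1)] by simp
    next
      case False
      then show ?thesis using zero grow by simp
    qed
  next
    case (Alice a p q)
    show ?case
    \<comment> \<open>An actual input pair is needed to conclude from \<open>bits\<close> that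
      \<open>c\<close> is positive; on an empty rectangle the indicator vanishes.\<close>
    proof (cases "A \<noteq> {} \<and> B \<noteq> {}")
      case True
      then obtain c' where c: "c = Suc c'"
        using Alice.prems by (metis Suc_le_D ex_in_conv num_bits.simps(2))
      have split: "of_bool (x \<in> A \<and> y \<in> B \<and> run (Alice a p q) x y = z)
         = (of_bool (x \<in> A \<inter> {x. \<not> a x} \<and> y \<in> B \<and> run p x y = z)
           + of_bool (x \<in> A \<inter> {x. a x} \<and> y \<in> B \<and> run q x y = z) :: real)" for x y
        by auto
      have "num_bits p x y \<le> c'" if "x \<in> A \<inter> {x. \<not> a x}" "y \<in> B" for x y
        using Alice.prems[of x y] that by (simp add: c)
      moreover have "num_bits q x y \<le> c'" if "x \<in> A \<inter> {x. a x}" "y \<in> B" for x y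
        using Alice.prems[of x y] that by (simp add: c)
      ultimately show ?thesis
        unfolding split add c
        using Alice.IH(1)[of "A \<inter> {x. \<not> a x}" B c'] Alice.IH(2)[of "A \<inter> {x. a x}" B c'] by simp
    next
      case False
      then show ?thesis using zero grow by auto
    qed
  next
    case (Bob b p q)
    show ?case
    proof (cases "A \<noteq> {} \<and> B \<noteq> {}")
      case True
      then obtain c' where c: "c = Suc c'"
        using Bob.prems by (metis Suc_le_D ex_in_conv num_bits.simps(3))
      have split: "of_bool (x \<in> A \<and> y \<in> B \<and> run (Bob b p q) x y = z)
         = (of_bool (x \<in> A \<and> y \<in> B \<inter> {y. \<not> b y} \<and> run p x y = z)
           + of_bool (x \<in> A \<and> y \<in> B \<inter> {y. b y} \<and> run q x y = z) :: real)" for x y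
        by auto
      have "num_bits p x y \<le> c'" if "x \<in> A" "y \<in> B \<inter> {y. \<not> b y}" for x y
        using Bob.prems[of x y] that by (simp add: c)
      moreover have "num_bits q x y \<le> c'" if "x \<in> A" "y \<in> B \<inter> {y. b y}" for x y
        using Bob.prems[of x y] that by (simp add: c)
      ultimately show ?thesis
        unfolding split add c
        using Bob.IH(1)[of A "B \<inter> {y. \<not> b y}" c'] Bob.IH(2)[of A "B \<inter> {y. b y}" c'] by simp
    next
      case False
      then show ?thesis using zero grow by auto
    qed
  qed
qed

section \<open>Additivity, total mass and monotonicity of the weights\<close>

lemma weight0_add: "weight0 U (\<lambda>x y. F x y + G x y) = weight0 U F + weight0 U G"
  by (simp add: weight0_def sum.distrib)

lemma weight1_add: "weight1 U (\<lambda>x y. F x y + G x y) = weight1 U F + weight1 U G"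
  by (simp add: weight1_def sum.distrib)

lemma weight_add: "weight U (\<lambda>x y. F x y + G x y) = weight U F + weight U G"
  by (simp add: weight_def sum.distrib)

text \<open>The factor 4 turns \<open>4 ^ (card U - 1)\<close> into \<open>4 ^ card U\<close>; for
  empty \<open>U\<close>, where the subtraction truncates, both sides are 0.\<close>

lemma weight0_const:
  assumes "finite U"
  shows "4 * weight0 U (\<lambda>x y. c) = c * card U * 4 ^ card U"
proof -
  have "(\<Sum>D\<in>Pow (U - {i}). \<Sum>x\<in>Pow D. \<Sum>y\<in>Pow (U - {i} - D). c) = c * 4 ^ (card U - 1)" if "i \<in> U" for i
  proof -
    have "(\<Sum>x\<in>Pow D. \<Sum>y\<in>Pow (U - {i} - D). c) = c * 2 ^ (card U - 1)" if D: "D \<in> Pow (U - {i})" for D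
    proof -
      have fD: "finite D" using D assms finite_subset by blast
      have "card D \<le> card (U - {i})" using D assms by (intro card_mono) auto
      then have "card D + card (U - {i} - D) = card U - 1"
        using D assms fD \<open>i \<in> U\<close> by (subst card_Diff_subset) auto
      then have "(2::real) ^ card D * 2 ^ card (U - {i} - D) = 2 ^ (card U - 1)"
        by (simp flip: power_add)
      then show ?thesis using fD assms by (simp add: card_Pow algebra_simps)
    qed
    then have "(\<Sum>D\<in>Pow (U - {i}). \<Sum>x\<in>Pow D. \<Sum>y\<in>Pow (U - {i} - D). c) = (\<Sum>D\<in>Pow (U - {i}). c * 2 ^ (card U - 1))"
      by (rule sum.cong[OF refl])
    also have "\<dots> = c * (2 ^ (card U - 1) * 2 ^ (card U - 1))"
      using assms that by (simp add: card_Pow)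
    finally show ?thesis by (simp flip: power_mult_distrib)
  qed
  then have "weight0 U (\<lambda>x y. c) = card U * (c * 4 ^ (card U - 1))"
    by (simp add: weight0_def)
  then show ?thesis by (cases "card U") auto
qed

lemma weight1_const: "weight1 U (\<lambda>x y. c) = weight0 U (\<lambda>x y. c)"
  by (simp add: weight1_def weight0_def)

lemma weight_const:
  assumes "finite U"
  shows "weight U (\<lambda>x y. c) = c * 4 ^ card U"
proof -
  have "(\<Sum>x\<in>Pow D. \<Sum>y\<in>Pow (U - D). c) = c * 2 ^ card U" if D: "D \<in> Pow U" for D
  proof -
    have fD: "finite D" using D assms finite_subset by blast
    have "card D \<le> card U" using D assms by (intro card_mono) auto
    then have "card D + card (U - D) = card U"
      using D assms fD by (subst card_Diff_subset) auto
    then have "(2::real) ^ card D * 2 ^ card (U - D) = 2 ^ card U"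
      by (simp flip: power_add)
    then show ?thesis using fD assms by (simp add: card_Pow algebra_simps)
  qed
  then have "weight U (\<lambda>x y. c) = (\<Sum>D\<in>Pow U. c * 2 ^ card U)"
    unfolding weight_def by (rule sum.cong[OF refl])
  also have "\<dots> = c * (2 ^ card U * 2 ^ card U)"
    using assms by (simp add: card_Pow)
  finally have "weight U (\<lambda>x y. c) = c * (2 ^ card U * 2 ^ card U)" .
  then show ?thesis by (simp flip: power_mult_distrib)
qed

text \<open>Only disjoint pairs occur in \<open>weight0\<close>, and only meeting pairs in
  \<open>weight1\<close>, so the acceptance bounds are required exactly there.\<close>

lemma weight0_mono:
  assumes "\<And>x y. x \<subseteq> U \<Longrightarrow> y \<subseteq> U \<Longrightarrow> x \<inter> y = {} \<Longrightarrow> F x y \<le> G x y"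
  shows "weight0 U F \<le> weight0 U G"
  unfolding weight0_def by (intro sum_mono assms) auto

lemma weight1_mono:
  assumes "\<And>x y. x \<subseteq> U \<Longrightarrow> y \<subseteq> U \<Longrightarrow> x \<inter> y \<noteq> {} \<Longrightarrow> F x y \<le> G x y"
  shows "weight1 U F \<le> weight1 U G"
  unfolding weight1_def by (intro sum_mono assms) auto

lemma weight_mono:
  assumes "\<And>x y. x \<subseteq> U \<Longrightarrow> y \<subseteq> U \<Longrightarrow> F x y \<le> G x y"
  shows "weight U F \<le> weight U G"
  unfolding weight_def by (intro sum_mono assms) auto

lemma prob_space_coins: "prob_space coins"
  unfolding coins_def by (intro prob_space_PiM measure_pmf.prob_space_axioms)

text \<open>Chosen so that \<open>bias_rate powr (n / 100)\<close> equals
  \<open>2 powr (- (disj_rate * n))\<close>; the 100 stems from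
  \<open>\<delta> = 1/100\<close>.\<close>

definition disj_rate :: real where
  "disj_rate = log 2 (1 / bias_rate) / 100"

lemma disj_rate_pos: "0 < disj_rate"
  using bias_rate_pos bias_rate_less_1 by (simp add: disj_rate_def)

text \<open>If \<open>E x y\<close> is the acceptance probability, then \<open>E \<ge> 2/3\<close> on disjoint and \<open>E \<le> 1/3\<close> on
  intersecting pairs, so the corruption functional of \<open>E\<close> is at least
  \<open>(2/3 - 25/16 \<cdot> 1/3) n 4\<^sup>n / 4 - 2 \<delta> n 4\<^sup>n\<close>; take \<open>\<delta> = 1/100\<close>.\<close>

lemma disjointness_bits:
  assumes U: "finite U"
    and P: "rand_computes (Pow U) (Pow U) (\<lambda>x y. x \<inter> y = {}) P"
    and bits: "\<And>r x y. x \<subseteq> U \<Longrightarrow> y \<subseteq> U \<Longrightarrow> num_bits (P r) x y \<le> c"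
  shows "disj_rate * card U - 7 \<le> c"
proof (cases "U = {}")
  case False
  interpret prob_space coins by (rule prob_space_coins)
  define n where "n = card U"
  have n: "0 < n" using False U by (simp add: n_def card_gt_0_iff)
  \<comment> \<open>The coefficient \<open>1/50\<close> is \<open>2 * \<delta>\<close>.\<close>
  define \<Phi> where "\<Phi> F = weight0 U F - 25/16 * weight1 U F - 1/50 * (real n * weight U F)" for F
  define g where "g r x y = (of_bool (x \<in> Pow U \<and> y \<in> Pow U \<and> run (P r) x y = True) :: real)" for r x y
  define E where "E x y = (\<integral>r. g r x y \<partial>coins)" for x y
  let ?\<kappa> = "2 * n * bias_rate powr (1/100 * n) * 4 ^ n"
  have g_le: "\<Phi> (g r) \<le> 2 ^ c * ?\<kappa>" for r
    unfolding g_def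
  proof (rule protocol_rectangles)
    show "\<Phi> (\<lambda>x y. F x y + G x y) = \<Phi> F + \<Phi> G" for F G
      by (simp add: \<Phi>_def weight0_add weight1_add weight_add algebra_simps add_divide_distrib)
    show "\<Phi> (\<lambda>x y. of_bool (x \<in> A \<and> y \<in> B)) \<le> ?\<kappa>" for A B
      using rectangle_corruption[OF U, of "1/100" A B] by (simp add: \<Phi>_def n_def)
    show "num_bits (P r) x y \<le> c" if "x \<in> Pow U" "y \<in> Pow U" for x y
      using bits that by auto
  qed
  define W where "W x y = {r \<in> space coins. run (P r) x y = (x \<inter> y = {})}" for x y
  have W: "W x y \<in> events" "2/3 \<le> prob (W x y)" if "x \<subseteq> U" "y \<subseteq> U" for x y
    using P that by (auto simp: rand_computes_def W_def)
  have disj: "g r x y = indicator (W x y) r"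
    if "x \<subseteq> U" "y \<subseteq> U" "x \<inter> y = {}" "r \<in> space coins" for r x y
    using that by (auto simp: g_def W_def indicator_def)
  have inter: "g r x y = indicator (space coins - W x y) r"
    if "x \<subseteq> U" "y \<subseteq> U" "x \<inter> y \<noteq> {}" "r \<in> space coins" for r x y
    using that by (auto simp: g_def W_def indicator_def)
  have out: "g r x y = 0" if "\<not> (x \<subseteq> U \<and> y \<subseteq> U)" for r x y
    using that by (auto simp: g_def)
  \<comment> \<open>Correctness yields measurability only for inputs inside \<open>U\<close>;
    elsewhere \<open>g\<close> is constantly 0.\<close>
  have int: "integrable coins (\<lambda>r. g r x y)" for x y
  proof (cases "x \<subseteq> U \<and> y \<subseteq> U")
    case True
    show ?thesis
    proof (cases "x \<inter> y = {}")
      case disjoint: True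
      have "integrable coins (indicator (W x y) :: _ \<Rightarrow> real)"
        using W(1) True by (simp add: emeasure_eq_measure)
      then show ?thesis
        using disj True disjoint by (subst Bochner_Integration.integrable_cong[OF refl]) auto
    next
      case False
      have "integrable coins (indicator (space coins - W x y) :: _ \<Rightarrow> real)"
        using W(1) True by (simp add: emeasure_eq_measure)
      then show ?thesis
        using inter True False by (subst Bochner_Integration.integrable_cong[OF refl]) auto
    qed
  qed (simp add: out)
  have E_disj: "2/3 \<le> E x y" if "x \<subseteq> U" "y \<subseteq> U" "x \<inter> y = {}" for x y
  proof -
    have "E x y = (\<integral>r. indicator (W x y) r \<partial>coins)"
      unfolding E_def using disj that by (intro Bochner_Integration.integral_cong) auto
    then show ?thesis using W[of x y] that by (simp add: Int_absorb1 sets.sets_into_space)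
  qed
  have E_inter: "E x y \<le> 1/3" if "x \<subseteq> U" "y \<subseteq> U" "x \<inter> y \<noteq> {}" for x y
  proof -
    have "E x y = (\<integral>r. indicator (space coins - W x y) r \<partial>coins)"
      unfolding E_def using inter that by (intro Bochner_Integration.integral_cong) auto
    also have "\<dots> = 1 - prob (W x y)"
      using W(1)[of x y] that prob_compl by (simp add: Int_absorb1)
    finally show ?thesis using W[of x y] that by simp
  qed
  have E_le: "E x y \<le> 1" for x y
    unfolding E_def using int by (intro integral_le_const) (auto simp: g_def)
  \<comment> \<open>\<open>\<Phi>\<close> is a finite linear combination of values, so it commutes
    with the expectation.\<close>
  have "\<Phi> E = (\<integral>r. \<Phi> (g r) \<partial>coins)"
    unfolding \<Phi>_def weight0_def weight1_def weight_def E_def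
    using int by simp
  also have "\<dots> \<le> 2 ^ c * ?\<kappa>"
  proof (rule integral_le_const)
    show "integrable coins (\<lambda>r. \<Phi> (g r))"
      unfolding \<Phi>_def weight0_def weight1_def weight_def using int by simp
  qed (use g_le in auto)
  finally have upper: "\<Phi> E \<le> 2 ^ c * ?\<kappa>" .
  have "weight0 U (\<lambda>x y. 2/3) \<le> weight0 U E"
    by (rule weight0_mono) (rule E_disj)
  moreover have "weight1 U E \<le> weight1 U (\<lambda>x y. 1/3)"
    by (rule weight1_mono) (rule E_inter)
  moreover have "weight U E \<le> weight U (\<lambda>x y. 1)"
    by (rule weight_mono) (rule E_le)
  then have "real n * weight U E \<le> real n * 4 ^ n"
    using U by (intro mult_left_mono) (auto simp: weight_const n_def)
  moreover have "weight0 U (\<lambda>x y. 2/3) = real n * 4 ^ n / 6" "weight1 U (\<lambda>x y. 1/3) = real n * 4 ^ n / 12"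
    using weight0_const[OF U, of "2/3"] weight0_const[OF U, of "1/3"]
    by (simp_all add: weight1_const n_def)
  moreover have "0 \<le> real n * 4 ^ n" by simp
  \<comment> \<open>In units of \<open>n * 4 ^ n\<close> the bound is
    \<open>1/6 - 25/192 - 1/50\<close>, slightly above \<open>1/64\<close>.\<close>
  ultimately have "(real n * 4 ^ n) * (1/64) \<le> \<Phi> E"
    unfolding \<Phi>_def by linarith
  then have "(real n * 4 ^ n) * (1/64) \<le> (real n * 4 ^ n) * (2 ^ c * 2 * bias_rate powr (1/100 * n))"
    using upper by (simp add: algebra_simps)
  then have "1/64 \<le> 2 ^ c * 2 * bias_rate powr (1/100 * n)"
    using n by (subst (asm) mult_le_cancel_left_pos) auto
  also have "bias_rate powr (1/100 * n) = 2 powr (- (disj_rate * n))"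
  proof -
    have "bias_rate = 2 powr (- (100 * disj_rate))"
      using bias_rate_pos by (simp add: disj_rate_def log_divide)
    then have "bias_rate powr (1/100 * n) = (2 powr (- (100 * disj_rate))) powr (1/100 * n)"
      by (rule arg_cong)
    then show ?thesis by (simp add: powr_powr)
  qed
  also have "2 ^ c * 2 * 2 powr (- (disj_rate * n)) = 2 powr (c + 1 - disj_rate * n)"
    by (simp add: powr_realpow[symmetric] powr_add powr_diff powr_minus_divide)
  \<comment> \<open>The 7 in the claim is this 6 plus the 1 contributed by the factor 2 in
    \<open>?\<kappa>\<close>.\<close>
  finally have "2 powr (-6) \<le> 2 powr (real c + 1 - disj_rate * n)"
    by (simp add: powr_minus powr_numeral add.commute)
  then show ?thesis by (simp add: n_def)
qed simp

subsection \<open>Comparison of the complexity measures\<close>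

primrec pullback :: "('a \<Rightarrow> 'c) \<Rightarrow> ('b \<Rightarrow> 'd) \<Rightarrow> ('c, 'd, 'e) protocol \<Rightarrow> ('a, 'b, 'e) protocol" where
  "pullback \<phi> \<psi> (Output z) = Output z"
| "pullback \<phi> \<psi> (Alice a p q) = Alice (\<lambda>x. a (\<phi> x)) (pullback \<phi> \<psi> p) (pullback \<phi> \<psi> q)"
| "pullback \<phi> \<psi> (Bob b p q) = Bob (\<lambda>y. b (\<psi> y)) (pullback \<phi> \<psi> p) (pullback \<phi> \<psi> q)"

lemma run_pullback [simp]: "run (pullback \<phi> \<psi> p) x y = run p (\<phi> x) (\<psi> y)"
  by (induction p) auto

lemma num_bits_pullback [simp]: "num_bits (pullback \<phi> \<psi> p) x y = num_bits p (\<phi> x) (\<psi> y)"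
  by (induction p) auto

text \<open>By discreteness, an infimum \<open>c\<close> lies below \<open>Suc c\<close>, hence so
  does some value. Finite cost thus provides an optimal protocol.\<close>

lemma INF_enat_attained:
  assumes "(INF i\<in>I. f i) = enat c"
  obtains i where "i \<in> I" "f i \<le> enat c"
proof -
  have "(INF i\<in>I. f i) < enat (Suc c)" using assms by simp
  then obtain i where "i \<in> I" "f i < enat (Suc c)" by (auto simp: INF_less_iff)
  then show ?thesis using that[of i] by (cases "f i") auto
qed

text \<open>Each player can apply \<open>\<phi>\<close> or \<open>\<psi>\<close> privately before
  running a protocol for \<open>f\<close>, so disjointness on \<open>U\<close> costs no more than
  \<open>f\<close>.\<close>

lemma rand_cc_ge_disj:
  assumes U: "finite U"
    and "\<And>x. x \<subseteq> U \<Longrightarrow> \<phi> x \<in> X" "\<And>y. y \<subseteq> U \<Longrightarrow> \<psi> y \<in> Y"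
    and f: "\<And>x y. x \<subseteq> U \<Longrightarrow> y \<subseteq> U \<Longrightarrow> f (\<phi> x) (\<psi> y) \<longleftrightarrow> x \<inter> y = {}"
  shows "ereal (disj_rate * card U - 7) \<le> ereal_of_enat (rand_cc X Y f)"
proof (cases "rand_cc X Y f")
  case (enat c)
  then obtain P where P: "rand_computes X Y f P"
      and c: "(SUP r. SUP x\<in>X. SUP y\<in>Y. enat (num_bits (P r) x y)) \<le> enat c"
    unfolding rand_cc_def by (rule INF_enat_attained) auto
  have "disj_rate * card U - 7 \<le> c"
  proof (rule disjointness_bits[OF U])
    show "rand_computes (Pow U) (Pow U) (\<lambda>x y. x \<inter> y = {}) (\<lambda>r. pullback \<phi> \<psi> (P r))"
      using P assms(2,3) unfolding rand_computes_def by (auto simp flip: f)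
    show "num_bits (pullback \<phi> \<psi> (P r)) x y \<le> c" if "x \<subseteq> U" "y \<subseteq> U" for r x y
      using c assms(2,3) that by (simp add: SUP_le_iff)
  qed
  then show ?thesis by (simp add: enat)
qed simp

text \<open>A deterministic protocol is a public-coin protocol that ignores the coins and never
  errs.\<close>

lemma rand_cc_le_det_cc: "rand_cc X Y f \<le> det_cc X Y f"
  unfolding det_cc_def
proof (rule INF_greatest)
  fix p assume p: "p \<in> {p. \<forall>x\<in>X. \<forall>y\<in>Y. run p x y = f x y}"
  interpret prob_space coins by (rule prob_space_coins)
  have "rand_computes X Y f (\<lambda>r. p)"
    using p by (auto simp: rand_computes_def prob_space)
  then show "rand_cc X Y f \<le> (SUP x\<in>X. SUP y\<in>Y. enat (num_bits p x y))"
    unfolding rand_cc_def by (intro INF_lower2[of "\<lambda>r. p"]) auto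
qed

text \<open>Leaves carry fixed outputs, while in the one-way model Bob alone computes the answer;
  hence his final bit. The argument \<open>m\<close> collects the bits already sent.\<close>

primrec send ::
  "('a \<Rightarrow> bool list) \<Rightarrow> (bool list \<Rightarrow> 'b \<Rightarrow> bool) \<Rightarrow> nat \<Rightarrow> bool list \<Rightarrow> ('a, 'b, bool) protocol" where
  "send msg out 0 m = Bob (out m) (Output False) (Output True)"
| "send msg out (Suc k) m =
     Alice (\<lambda>x. msg x ! length m) (send msg out k (m @ [False])) (send msg out k (m @ [True]))"

lemma send_correct:
  assumes "length (msg x) = length m + k" "m = take (length m) (msg x)"
  shows "run (send msg out k m) x y = out (msg x) y"
  using assms
proof (induction k arbitrary: m)
  case (Suc k)
  have "take (Suc (length m)) (msg x) = m @ [msg x ! length m]"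
    using Suc.prems by (simp add: take_Suc_conv_app_nth)
  then show ?case
    using Suc.IH[of "m @ [msg x ! length m]"] Suc.prems(1) by (cases "msg x ! length m") auto
qed simp

lemma num_bits_send [simp]: "num_bits (send msg out k m) x y = Suc k"
  by (induction k arbitrary: m) auto

lemma det_cc_le_oneway_cc:
  fixes f :: "'a \<Rightarrow> 'b \<Rightarrow> bool"
  shows "det_cc X Y f \<le> oneway_cc X Y f + 1"
proof (cases "oneway_cc X Y f")
  case (enat c)
  then obtain k :: nat where k: "k \<le> c" and
    "\<exists>(msg :: 'a \<Rightarrow> bool list) (out :: bool list \<Rightarrow> 'b \<Rightarrow> bool).
       (\<forall>x\<in>X. length (msg x) = k) \<and> (\<forall>x\<in>X. \<forall>y\<in>Y. out (msg x) y = f x y)"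
    unfolding oneway_cc_def by (rule INF_enat_attained) auto
  then obtain msg :: "'a \<Rightarrow> bool list" and out where
    msg: "\<forall>x\<in>X. length (msg x) = k" "\<forall>x\<in>X. \<forall>y\<in>Y. out (msg x) y = f x y"
    by blast
  have "det_cc X Y f \<le> (SUP x\<in>X. SUP y\<in>Y. enat (num_bits (send msg out k []) x y))"
    unfolding det_cc_def using msg by (intro INF_lower) (auto simp: send_correct)
  also have "\<dots> \<le> enat (Suc k)"
    by (intro SUP_least) simp
  also have "\<dots> \<le> enat c + 1" using k by (simp add: one_enat_def)
  finally show ?thesis by (simp add: enat)
qed simp

text \<open>Alice sends only \<open>h x\<close>: by counting, its values have an injective code of
  words of length exactly \<open>k\<close>, which Bob inverts.\<close>

lemma oneway_cc_le:
  assumes "finite (h ` X)" "card (h ` X) \<le> 2 ^ k"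
    and f: "\<And>x y. x \<in> X \<Longrightarrow> y \<in> Y \<Longrightarrow> f x y = g (h x) y"
  shows "oneway_cc X Y f \<le> enat k"
proof -
  have "card {xs :: bool list. length xs = k} = 2 ^ k"
    using card_lists_length_eq[of "UNIV :: bool set" k] by simp
  moreover have "finite {xs :: bool list. length xs = k}"
    using finite_lists_length_eq[of "UNIV :: bool set" k] by simp
  ultimately obtain enc where enc: "inj_on enc (h ` X)" "enc ` h ` X \<subseteq> {xs :: bool list. length xs = k}"
    using assms(1,2) inj_on_iff_card_le by metis
  show ?thesis
    unfolding oneway_cc_def
  proof (intro INF_lower CollectI exI conjI ballI)
    show "length ((enc \<circ> h) x) = k" if "x \<in> X" for x using enc(2) that by auto
    show "(\<lambda>m. g (inv_into (h ` X) enc m)) ((enc \<circ> h) x) y = f x y" if "x \<in> X" "y \<in> Y" for x y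
      using enc(1) that by (simp add: f)
  qed
qed

subsection \<open>Lines through a grid in general position\<close>

lemma line_eq_affine_hull:
  assumes "l \<in> lines" "p \<in> l" "q \<in> l" "p \<noteq> q"
  shows "l = affine hull {p, q}"
proof -
  have "affine hull {p, q} = l"
  proof (rule affine_dim_equal)
    show "affine hull {p, q} \<subseteq> l"
      using assms by (intro hull_minimal) (auto simp: lines_def)
    show "aff_dim (affine hull {p, q}) = aff_dim l"
      using assms by (simp add: lines_def)
  qed (use assms in \<open>auto simp: lines_def\<close>)
  then show ?thesis ..
qed

text \<open>The cross product of two directions along a line vanishes; avoiding slopes spares a
  separate case for vertical lines.\<close>

lemma line_collinear:
  assumes "l \<in> lines" "p \<in> l" "q \<in> l" "r \<in> l"
  shows "(fst q - fst p) * (snd r - snd p) = (fst r - fst p) * (snd q - snd p)"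
proof (cases "p = q")
  case False
  then have "r \<in> affine hull {p, q}" using line_eq_affine_hull assms by blast
  then obtain u where "r = p + u *\<^sub>R (q - p)" unfolding affine_hull_2_alt by blast
  then have "fst r = fst p + u * (fst q - fst p)" "snd r = snd p + u * (snd q - snd p)"
    by simp_all
  then show ?thesis by (simp only:) (simp add: algebra_simps)
qed simp

lemma affine_hull_vertical:
  fixes p q :: "real \<times> real"
  assumes "snd p \<noteq> snd q" "fst p = fst q"
  shows "affine hull {p, q} = {z. fst z = fst p}"
proof (intro equalityI subsetI)
  fix z :: "real \<times> real" assume "z \<in> {z. fst z = fst p}"
  then have "z = p + ((snd z - snd p) / (snd q - snd p)) *\<^sub>R (q - p)"
    using assms by (auto simp: prod_eq_iff)
  then show "z \<in> affine hull {p, q}" unfolding affine_hull_2_alt by blast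
qed (use assms in \<open>auto simp: affine_hull_2_alt\<close>)

lemma affine_hull_horizontal:
  fixes p q :: "real \<times> real"
  assumes "fst p \<noteq> fst q" "snd p = snd q"
  shows "affine hull {p, q} = {z. snd z = snd p}"
proof (intro equalityI subsetI)
  fix z :: "real \<times> real" assume "z \<in> {z. snd z = snd p}"
  then have "z = p + ((fst z - fst p) / (fst q - fst p)) *\<^sub>R (q - p)"
    using assms by (auto simp: prod_eq_iff)
  then show "z \<in> affine hull {p, q}" unfolding affine_hull_2_alt by blast
qed (use assms in \<open>auto simp: affine_hull_2_alt\<close>)

definition vertical :: "nat \<Rightarrow> (real \<times> real) set" where
  "vertical a = {z. fst z = real a}"

text \<open>The base exceeds \<open>n + 1\<close>, which is what rules out a third collinear point,
  and is at least 2 even for \<open>n = 0\<close>, which keeps the heights distinct.\<close>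

definition horizontal :: "nat \<Rightarrow> nat \<Rightarrow> (real \<times> real) set" where
  "horizontal n c = {z. snd z = real ((n + 2) ^ c)}"

lemma vertical_in_lines: "vertical a \<in> lines"
proof -
  have "vertical a = affine hull {(real a, 0), (real a, 1)}"
    by (subst affine_hull_vertical) (auto simp: vertical_def)
  then show ?thesis by (simp add: lines_def)
qed

lemma horizontal_in_lines: "horizontal n c \<in> lines"
proof -
  have "horizontal n c = affine hull {(0, real ((n + 2) ^ c)), (1, real ((n + 2) ^ c))}"
    by (subst affine_hull_horizontal) (auto simp: horizontal_def)
  then show ?thesis by (simp add: lines_def)
qed

definition grid_point :: "nat \<Rightarrow> nat \<times> nat \<Rightarrow> real \<times> real" where
  "grid_point n = (\<lambda>(a, c). (real a, real ((n + 2) ^ c)))"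

lemma inj_grid_point: "inj (grid_point n)"
proof (rule injI)
  fix u v assume "grid_point n u = grid_point n v"
  then have "fst u = fst v" "real ((n + 2) ^ snd u) = real ((n + 2) ^ snd v)"
    by (auto simp: grid_point_def split_beta)
  then have "(n + 2) ^ snd u = (n + 2) ^ snd v" by (simp only: of_nat_eq_iff)
  then have "snd u = snd v" by (simp add: power_inject_exp)
  with \<open>fst u = fst v\<close> show "u = v" by (simp add: prod_eq_iff)
qed

text \<open>The vertical gap above the middle point exceeds the one below it by a factor larger than \<open>n\<close>,
  while the ratio of the horizontal gaps is at most \<open>n\<close>.\<close>

lemma no_three_collinear:
  assumes "l \<in> lines" "{u, v, w} \<subseteq> l" "{u, v, w} \<subseteq> grid_point n ` ({..n} \<times> {..n})"
    and "fst u \<noteq> fst v" "snd u < snd v" "snd v < snd w"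
  shows False
proof -
  obtain a1 a2 a3 c1 c2 c3 where le: "a1 \<le> n" "a2 \<le> n" "a3 \<le> n"
    and u: "u = (real a1, real ((n + 2) ^ c1))" and v: "v = (real a2, real ((n + 2) ^ c2))"
    and w: "w = (real a3, real ((n + 2) ^ c3))"
    using assms(3) by (auto simp: grid_point_def)
  have "(n + 2) ^ c2 < (n + 2) ^ c3" using assms(6) by (simp only: v w snd_conv of_nat_less_iff)
  then have "c2 < c3" by (simp add: power_strict_increasing_iff)
  then have "(n + 2) ^ Suc c2 \<le> (n + 2) ^ c3" by (intro power_increasing) auto
  then have "real ((n + 2) ^ Suc c2) \<le> real ((n + 2) ^ c3)" by (simp only: of_nat_le_iff)
  then have big: "(real n + 2) * snd v \<le> snd w" by (simp add: v w algebra_simps)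
  have pos: "0 < snd u" "0 < snd v" by (simp_all add: u v add_pos_pos)
  have "(fst u - fst v) * (snd w - snd v) = (fst w - fst v) * (snd u - snd v)"
    using assms(1,2) by (intro line_collinear) auto
  then have "\<bar>(fst u - fst v) * (snd w - snd v)\<bar> = \<bar>(fst w - fst v) * (snd u - snd v)\<bar>"
    by (rule arg_cong)
  then have "\<bar>fst u - fst v\<bar> * (snd w - snd v) = \<bar>fst w - fst v\<bar> * (snd v - snd u)"
    using assms(5,6) by (simp add: abs_mult)
  moreover have "1 * (snd w - snd v) \<le> \<bar>fst u - fst v\<bar> * (snd w - snd v)"
    using assms(4,6) by (intro mult_right_mono) (auto simp: u v)
  moreover have "\<bar>fst w - fst v\<bar> * (snd v - snd u) \<le> real n * snd v"
    using assms(5) pos le by (intro mult_mono) (auto simp: v w)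
  ultimately have "snd w - snd v \<le> real n * snd v" by (simp only: mult_1 order.trans)
  then show False using big pos by (simp add: algebra_simps)
qed

section \<open>Traces of lines on the grid\<close>

definition atoms :: "nat \<Rightarrow> (real \<times> real) set \<Rightarrow> (real \<times> real) set set" where
  "atoms n G = (\<lambda>a. vertical a \<inter> G) ` {..n} \<union> (\<lambda>c. horizontal n c \<inter> G) ` {..n} \<union> (\<lambda>p. {p}) ` G"

lemma finite_atoms: "finite G \<Longrightarrow> finite (atoms n G)"
  by (simp add: atoms_def)

lemma card_atoms_le:
  assumes "finite G"
  shows "card (atoms n G) \<le> 2 * (n + 1) + card G"
proof -
  let ?V = "(\<lambda>a. vertical a \<inter> G) ` {..n}" and ?H = "(\<lambda>c. horizontal n c \<inter> G) ` {..n}"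
  have "card (f ` {..n}) \<le> n + 1" for f :: "nat \<Rightarrow> (real \<times> real) set"
    using card_image_le[of "{..n}" f] by simp
  then have "card ?V \<le> n + 1" "card ?H \<le> n + 1" by blast+
  moreover have "card ((\<lambda>p. {p}) ` G) \<le> card G" using assms by (rule card_image_le)
  moreover have "card (atoms n G) \<le> card ?V + card ?H + card ((\<lambda>p. {p}) ` G)"
    unfolding atoms_def using card_Un_le[of "?V \<union> ?H"] card_Un_le[of ?V ?H]
    by (meson add_le_mono1 le_trans)
  ultimately show ?thesis by simp
qed

text \<open>Two trace points sharing a coordinate force a vertical or horizontal line, whose trace
  is a single atom. Otherwise \<open>no_three_collinear\<close> leaves at most two points, each a
  singleton atom.\<close>

lemma line_trace:
  assumes l: "l \<in> lines" and G: "G \<subseteq> grid_point n ` ({..n} \<times> {..n})"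
  obtains Q where "Q \<subseteq> atoms n G" "finite Q" "card Q \<le> 2" "l \<inter> G = \<Union>Q"
proof -
  have coord: "\<exists>a\<le>n. fst p = real a" "\<exists>c\<le>n. snd p = real ((n + 2) ^ c)" if "p \<in> G" for p
    using G that by (auto simp: grid_point_def)
  consider (vert) p q where "p \<in> l \<inter> G" "q \<in> l \<inter> G" "p \<noteq> q" "fst p = fst q"
    | (hor) p q where "p \<in> l \<inter> G" "q \<in> l \<inter> G" "p \<noteq> q" "snd p = snd q"
    | (generic) "\<And>p q. p \<in> l \<inter> G \<Longrightarrow> q \<in> l \<inter> G \<Longrightarrow> p \<noteq> q \<Longrightarrow> fst p \<noteq> fst q \<and> snd p \<noteq> snd q"
    by blast
  then show ?thesis
  proof cases
    case vert
    have "l = affine hull {p, q}" using vert l by (intro line_eq_affine_hull) auto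
    also have "\<dots> = {z. fst z = fst p}" using vert by (intro affine_hull_vertical) (auto simp: prod_eq_iff)
    finally have "l \<inter> G \<in> atoms n G"
      using coord(1)[of p] vert by (auto simp: atoms_def vertical_def)
    then show ?thesis using that[of "{l \<inter> G}"] by simp
  next
    case hor
    have "l = affine hull {p, q}" using hor l by (intro line_eq_affine_hull) auto
    also have "\<dots> = {z. snd z = snd p}" using hor by (intro affine_hull_horizontal) (auto simp: prod_eq_iff)
    finally have "l \<inter> G \<in> atoms n G"
      using coord(2)[of p] hor by (auto simp: atoms_def horizontal_def)
    then show ?thesis using that[of "{l \<inter> G}"] by simp
  next
    case generic
    have fin: "finite (l \<inter> G)" using G finite_subset by blast
    have "card (l \<inter> G) \<le> 2"
    proof (rule ccontr)
      assume "\<not> card (l \<inter> G) \<le> 2"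
      then obtain T where T: "T \<subseteq> l \<inter> G" "card T = 3"
        using obtain_subset_with_card_n[of 3 "l \<inter> G"] by (metis not_less_eq_eq numeral_2_eq_2 numeral_3_eq_3)
      then obtain p q r where pqr: "T = {p, q, r}" "p \<noteq> q" "q \<noteq> r" "p \<noteq> r"
        by (auto simp: card_3_iff)
      have "snd p \<noteq> snd q" "snd q \<noteq> snd r" "snd p \<noteq> snd r"
        using generic T pqr by auto
      then have "snd p < snd q \<or> snd q < snd p" "snd q < snd r \<or> snd r < snd q" "snd p < snd r \<or> snd r < snd p"
        by linarith+
      \<comment> \<open>Sorting the three points by height provides the order that
        \<open>no_three_collinear\<close> expects.\<close>
      then have "\<exists>u\<in>T. \<exists>v\<in>T. \<exists>w\<in>T. snd u < snd v \<and> snd v < snd w"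
        unfolding pqr(1) by (elim disjE) auto
      then obtain u v w where uvw: "u \<in> T" "v \<in> T" "w \<in> T" "snd u < snd v" "snd v < snd w"
        by blast
      moreover have "fst u \<noteq> fst v"
        using generic[of u v] uvw T by auto
      ultimately show False
        using no_three_collinear[OF l, of u v w n] T G by blast
    qed
    then show ?thesis
      using fin that[of "(\<lambda>p. {p}) ` (l \<inter> G)"] card_image_le[OF fin, of "\<lambda>p. {p}"] by (auto simp: atoms_def)
  qed
qed

lemma family_trace:
  assumes S: "S \<in> line_families d" and G: "G \<subseteq> grid_point n ` ({..n} \<times> {..n})"
  shows "\<Union>S \<inter> G \<in> Union ` {Q. Q \<subseteq> atoms n G \<and> card Q \<le> 2 * d}"
proof -
  have "\<exists>Q. Q \<subseteq> atoms n G \<and> finite Q \<and> card Q \<le> 2 \<and> l \<inter> G = \<Union>Q" if "l \<in> S" for l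
  proof -
    have "l \<in> lines" using that S by (auto simp: line_families_def)
    then show ?thesis using G by (rule line_trace) blast
  qed
  then obtain q where q: "\<And>l. l \<in> S \<Longrightarrow> q l \<subseteq> atoms n G \<and> finite (q l) \<and> card (q l) \<le> 2 \<and> l \<inter> G = \<Union>(q l)"
    by metis
  have "card (\<Union>l\<in>S. q l) \<le> (\<Sum>l\<in>S. card (q l))"
    using S by (intro card_UN_le) (auto simp: line_families_def)
  also have "\<dots> \<le> (\<Sum>l\<in>S. 2)" using q by (intro sum_mono) auto
  also have "\<dots> = 2 * d" using S by (simp add: line_families_def)
  finally have "card (\<Union>l\<in>S. q l) \<le> 2 * d" .
  moreover have "\<Union>S \<inter> G = \<Union>(\<Union>l\<in>S. q l)"
  proof -
    have "\<Union>S \<inter> G = (\<Union>l\<in>S. l \<inter> G)" by blast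
    also have "\<dots> = (\<Union>l\<in>S. \<Union>(q l))" using q by (intro SUP_cong) auto
    finally show ?thesis by blast
  qed
  moreover have "(\<Union>l\<in>S. q l) \<subseteq> atoms n G"
    using q by (intro UN_least) auto
  ultimately show ?thesis
    by (intro image_eqI[of _ _ "\<Union>l\<in>S. q l"]) auto
qed

text \<open>The label \<open>h (b, Z)\<close> records the block as well as the subset. Hence equal
  slices in different blocks still give different lines, as a family of exactly \<open>d\<close>
  lines demands, and crossings between different blocks can be left out of \<open>G\<close>.\<close>

lemma grid_disjointness:
  assumes "d * 4 ^ k \<le> n"
  obtains G \<phi> \<psi> where "G \<subseteq> grid_point n ` ({..n} \<times> {..n})" "card G = n"
    "\<And>x. x \<subseteq> {..<d} \<times> {..<k} \<Longrightarrow> \<phi> x \<in> line_families d"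
    "\<And>y. y \<subseteq> {..<d} \<times> {..<k} \<Longrightarrow> \<psi> y \<in> line_families d"
    "\<And>x y. x \<subseteq> {..<d} \<times> {..<k} \<Longrightarrow> y \<subseteq> {..<d} \<times> {..<k} \<Longrightarrow> line_disj G (\<phi> x) (\<psi> y) \<longleftrightarrow> x \<inter> y = {}"
proof -
  let ?B = "{..<d} \<times> Pow {..<k}"
  have card_B: "card ?B = d * 2 ^ k" and "finite ?B" by (simp_all add: card_Pow)
  obtain h where bij: "bij_betw h ?B {0..<d * 2 ^ k}"
    using ex_bij_betw_finite_nat[OF \<open>finite ?B\<close>] unfolding card_B by blast
  have "d * 2 ^ k \<le> n"
  proof -
    have "(2::nat) ^ k \<le> 4 ^ k" by (rule power_mono) auto
    then show ?thesis using assms by (meson le_trans mult_le_mono2)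
  qed
  then have h: "h z < n" if "z \<in> ?B" for z
    using bij_betwE[OF bij] that by (meson atLeastLessThan_iff order_less_le_trans)
  have inj: "inj_on h ?B" using bij by (rule bij_betw_imp_inj_on)
  define T where "T = {(b, Z, W). b < d \<and> Z \<subseteq> {..<k} \<and> W \<subseteq> {..<k} \<and> Z \<inter> W \<noteq> {}}"
  define M0 where "M0 = (\<lambda>(b, Z, W). (h (b, Z), h (b, W))) ` T"
  let ?C = "{..<d} \<times> Pow {..<k} \<times> Pow {..<k}"
  have TC: "T \<subseteq> ?C" by (auto simp: T_def)
  have finC: "finite ?C" by simp
  have finT: "finite T" using TC finC by (rule finite_subset)
  then have finM0: "finite M0" by (simp add: M0_def)
  have "card M0 \<le> card T" unfolding M0_def using finT by (rule card_image_le)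
  also have "\<dots> \<le> card ?C" using finC TC by (rule card_mono)
  also have "\<dots> = d * 4 ^ k"
    by (simp add: card_cartesian_product card_Pow flip: power_mult_distrib)
  finally have "card M0 \<le> d * 4 ^ k" .
  then have cardM0: "card M0 \<le> n" using assms by simp
  \<comment> \<open>Padding to exactly \<open>n\<close> points happens in column \<open>n\<close>.
    Alice's lines have labels below \<open>n\<close>, so the padding creates no
    intersections.\<close>
  define M where "M = M0 \<union> {n} \<times> {..<n - card M0}"
  have M0n: "fst z < n" "snd z < n" if z: "z \<in> M0" for z
  proof -
    obtain b Z W where "z = (h (b, Z), h (b, W))" "(b, Z) \<in> ?B" "(b, W) \<in> ?B"
      using z by (auto simp: M0_def T_def)
    then show "fst z < n" "snd z < n" using h by simp_all
  qed
  have "M0 \<inter> {n} \<times> {..<n - card M0} = {}"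
  proof (rule equals0I)
    fix z assume z: "z \<in> M0 \<inter> {n} \<times> {..<n - card M0}"
    then have "fst z = n" by auto
    then show False using M0n(1)[of z] z by simp
  qed
  then have cardM: "card M = n"
    unfolding M_def using finM0 cardM0 by (subst card_Un_disjoint) auto
  have Mn: "M \<subseteq> {..n} \<times> {..n}"
  proof
    fix z assume "z \<in> M"
    then consider "z \<in> M0" | "fst z = n" "snd z < n" by (auto simp: M_def)
    then show "z \<in> {..n} \<times> {..n}"
      using M0n[of z] by cases (simp_all add: mem_Times_iff)
  qed
  define G where "G = grid_point n ` M"
  define slice where "slice x b = {j. (b, j) \<in> x}" for x :: "(nat \<times> nat) set" and b
  define \<phi> where "\<phi> x = (\<lambda>b. vertical (h (b, slice x b))) ` {..<d}" for x
  define \<psi> where "\<psi> y = (\<lambda>b. horizontal n (h (b, slice y b))) ` {..<d}" for y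
  have slice: "(b, slice x b) \<in> ?B" if "x \<subseteq> {..<d} \<times> {..<k}" "b < d" for x b
    using that by (auto simp: slice_def)
  have hinj: "h (b, Z) = h (b', Z') \<longleftrightarrow> b = b' \<and> Z = Z'" if "(b, Z) \<in> ?B" "(b', Z') \<in> ?B" for b b' Z Z'
    using inj_on_eq_iff[OF inj that] by simp
  have vinj: "vertical a = vertical a' \<longleftrightarrow> a = a'" for a a'
    by (auto simp: vertical_def set_eq_iff)
  have heq: "horizontal n c = horizontal n c' \<longleftrightarrow> c = c'" for c c'
  proof
    assume "horizontal n c = horizontal n c'"
    moreover have "(0, real ((n + 2) ^ c)) \<in> horizontal n c" by (simp add: horizontal_def)
    ultimately have "(0, real ((n + 2) ^ c)) \<in> horizontal n c'" by simp
    then have "grid_point n (0, c) = grid_point n (0, c')" by (simp add: horizontal_def grid_point_def)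
    then show "c = c'" using inj_grid_point[of n] by (auto dest: injD)
  qed simp
  have point: "vertical a \<inter> horizontal n c = {grid_point n (a, c)}" for a c
    by (auto simp: vertical_def horizontal_def grid_point_def)
  show ?thesis
  proof (rule that)
    show "G \<subseteq> grid_point n ` ({..n} \<times> {..n})" using Mn by (auto simp: G_def)
    show "card G = n"
      unfolding G_def using cardM inj_grid_point by (metis card_image inj_on_subset subset_UNIV)
    show "\<phi> x \<in> line_families d" if "x \<subseteq> {..<d} \<times> {..<k}" for x
    proof -
      have "inj_on (\<lambda>b. vertical (h (b, slice x b))) {..<d}"
        using that slice hinj by (intro inj_onI) (auto simp: vinj)
      then show ?thesis by (auto simp: line_families_def \<phi>_def card_image vertical_in_lines)
    qed
    show "\<psi> y \<in> line_families d" if "y \<subseteq> {..<d} \<times> {..<k}" for y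
    proof -
      have "inj_on (\<lambda>b. horizontal n (h (b, slice y b))) {..<d}"
        using that slice hinj by (intro inj_onI) (auto simp: heq)
      then show ?thesis by (auto simp: line_families_def \<psi>_def card_image horizontal_in_lines)
    qed
    show "line_disj G (\<phi> x) (\<psi> y) \<longleftrightarrow> x \<inter> y = {}"
      if x: "x \<subseteq> {..<d} \<times> {..<k}" and y: "y \<subseteq> {..<d} \<times> {..<k}" for x y
    proof -
      have mem: "grid_point n (h (b, slice x b), h (b', slice y b')) \<in> G
          \<longleftrightarrow> b = b' \<and> slice x b \<inter> slice y b \<noteq> {}" if b: "b < d" "b' < d" for b b'
      proof -
        have "grid_point n (h (b, slice x b), h (b', slice y b')) \<in> G
          \<longleftrightarrow> (h (b, slice x b), h (b', slice y b')) \<in> M"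
          unfolding G_def by (rule inj_image_mem_iff[OF inj_grid_point])
        also have "\<dots> \<longleftrightarrow> (h (b, slice x b), h (b', slice y b')) \<in> M0"
          using h[OF slice[OF x b(1)]] by (auto simp: M_def)
        also have "\<dots> \<longleftrightarrow> b = b' \<and> slice x b \<inter> slice y b \<noteq> {}"
        proof
          assume "(h (b, slice x b), h (b', slice y b')) \<in> M0"
          then obtain e Z W where "e < d" "Z \<subseteq> {..<k}" "W \<subseteq> {..<k}" "Z \<inter> W \<noteq> {}"
            "h (b, slice x b) = h (e, Z)" "h (b', slice y b') = h (e, W)"
            by (auto simp: M0_def T_def)
          then show "b = b' \<and> slice x b \<inter> slice y b \<noteq> {}"
            using slice[OF x b(1)] slice[OF y b(2)] by (auto simp: hinj)
        next
          assume "b = b' \<and> slice x b \<inter> slice y b \<noteq> {}"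
          then show "(h (b, slice x b), h (b', slice y b')) \<in> M0"
            using slice[OF x b(1)] slice[OF y b(2)] unfolding M0_def T_def
            by (intro image_eqI[of _ _ "(b, slice x b, slice y b)"]) auto
        qed
        finally show ?thesis .
      qed
      have "line_disj G (\<phi> x) (\<psi> y) \<longleftrightarrow>
          (\<forall>b<d. \<forall>b'<d. grid_point n (h (b, slice x b), h (b', slice y b')) \<notin> G)"
        by (auto simp: line_disj_def \<phi>_def \<psi>_def point)
      also have "\<dots> \<longleftrightarrow> (\<forall>b<d. slice x b \<inter> slice y b = {})"
        using mem by blast
      also have "\<dots> \<longleftrightarrow> x \<inter> y = {}"
        using x by (auto simp: slice_def)
      finally show ?thesis .
    qed
  qed
qed

subsection \<open>Line disjointness on the grid\<close>

text \<open>A trace is a union of at most \<open>2 * d\<close> of at most \<open>5 * n\<close>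
  atoms. The choice \<open>t = d / n\<close> makes \<open>(1 + t) ^ (5 * n)\<close> at most
  \<open>exp (5 * d)\<close>, which is exponential in \<open>d\<close> only.\<close>

lemma card_traces_le:
  assumes d: "1 \<le> d" "d \<le> n" and G: "G \<subseteq> grid_point n ` ({..n} \<times> {..n})" "card G = n"
  shows "finite ((\<lambda>S. \<Union>S \<inter> G) ` line_families d)"
    and "real (card ((\<lambda>S. \<Union>S \<inter> G) ` line_families d)) \<le> (real n / real d) ^ (2 * d) * 2 ^ (10 * d)"
proof -
  let ?Q = "{Q. Q \<subseteq> atoms n G \<and> card Q \<le> 2 * d}"
  define t where "t = real d / real n"
  have t: "0 < t" "t \<le> 1" using d by (simp_all add: t_def)
  have finG: "finite G" using G(1) by (rule finite_subset) simp
  have finA: "finite (atoms n G)" using finG by (rule finite_atoms)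
  then have finQ: "finite ?Q" by simp
  have sub: "(\<lambda>S. \<Union>S \<inter> G) ` line_families d \<subseteq> Union ` ?Q"
    using family_trace[OF _ G(1)] by (rule image_subsetI)
  show "finite ((\<lambda>S. \<Union>S \<inter> G) ` line_families d)"
    using sub finQ by (rule finite_subset[OF _ finite_imageI])
  have "card ((\<lambda>S. \<Union>S \<inter> G) ` line_families d) \<le> card (Union ` ?Q)"
    using finQ sub by (intro card_mono) auto
  also have "\<dots> \<le> card ?Q" using finQ by (rule card_image_le)
  finally have "real (card ((\<lambda>S. \<Union>S \<inter> G) ` line_families d)) \<le> real (card ?Q)" by simp
  moreover have "real (card ?Q) * t ^ (2 * d) \<le> 2 ^ (10 * d)"
  proof -
    \<comment> \<open>\<open>2 * (n + 1) + n \<le> 5 * n\<close> holds because \<open>n\<close> is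
      positive.\<close>
    have "card (atoms n G) \<le> 5 * n" using card_atoms_le[OF finG, of n] G(2) d by simp
    have "real (card ?Q) * t ^ (2 * d) \<le> (1 + t) ^ card (atoms n G)"
      using finA t by (rule card_subsets_le_bound)
    also have "\<dots> \<le> (1 + t) ^ (5 * n)"
      using \<open>card (atoms n G) \<le> 5 * n\<close> t by (intro power_increasing) auto
    also have "\<dots> \<le> exp t ^ (5 * n)"
      using t exp_ge_add_one_self[of t] by (intro power_mono) auto
    also have "\<dots> = exp 1 ^ (5 * d)"
      using d by (simp add: t_def flip: exp_of_nat_mult)
    also have "\<dots> \<le> (2 ^ 2) ^ (5 * d)"
      using exp_le by (intro power_mono) auto
    also have "\<dots> = 2 ^ (10 * d)" by (simp only: power_mult[symmetric]) simp
    finally show ?thesis .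
  qed
  then have "real (card ?Q) \<le> (real n / real d) ^ (2 * d) * 2 ^ (10 * d)"
    using d by (simp add: t_def power_divide field_simps)
  ultimately show "real (card ((\<lambda>S. \<Union>S \<inter> G) ` line_families d)) \<le> (real n / real d) ^ (2 * d) * 2 ^ (10 * d)"
    by (rule order.trans)
qed

text \<open>Alice sends the trace of her union of lines on \<open>G\<close>, and Bob tests whether
  it meets his own union.\<close>

lemma oneway_cc_line_disj_le:
  assumes d: "1 \<le> d" and G: "G \<subseteq> grid_point n ` ({..n} \<times> {..n})" "card G = n"
    and L: "1 \<le> log 2 (real n / real d)"
  shows "ereal_of_enat (oneway_cc (line_families d) (line_families d) (line_disj G))
      \<le> ereal (13 * (real d * log 2 (real n / real d)))"
proof -
  define L where "L = log 2 (real n / real d)"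
  \<comment> \<open>For \<open>n = 0\<close> the logarithm would take its default value 0.\<close>
  have "0 < n" using L by (intro gr0I) (simp add: log_def)
  then have pos: "0 < real n / real d" using d by simp
  have "2 powr 1 \<le> real n / real d" using L pos by (subst (asm) le_log_iff) auto
  then have "d \<le> n" using d by (simp add: field_simps)
  let ?T = "(\<lambda>S. \<Union>S \<inter> G) ` line_families d"
  note T = card_traces_le[OF d \<open>d \<le> n\<close> G]
  \<comment> \<open>Since \<open>L \<ge> 1\<close>, the exponent \<open>2 * d * L + 10 * d\<close>
    is at most \<open>12 * d * L\<close>; rounding up adds at most \<open>1 \<le> d * L\<close>,
    whence 13.\<close>
  define k where "k = nat \<lceil>12 * d * L\<rceil>"
  have "1 \<le> real d * L" using d L mult_mono[of 1 "real d" 1 L] by (simp add: L_def)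
  then have k: "12 * d * L \<le> k" "k \<le> 13 * (real d * L)"
    unfolding k_def by linarith+
  have "real n / real d = 2 powr L" using pos by (simp add: L_def)
  then have "(real n / real d) ^ (2 * d) * 2 ^ (10 * d) = 2 powr (2 * d * L + 10 * d)"
    by (simp add: powr_add powr_realpow[symmetric] powr_powr mult.commute)
  also have "\<dots> \<le> 2 powr k"
  proof -
    have "real d \<le> real d * L" using L d by (simp add: L_def)
    then have "2 * d * L + 10 * d \<le> k" using k(1) by linarith
    then show ?thesis by simp
  qed
  finally have "real (card ?T) \<le> 2 powr k"
    using T(2) by (rule order.trans[rotated])
  then have "real (card ?T) \<le> real (2 ^ k)"
    by (simp add: powr_realpow)
  then have "card ?T \<le> 2 ^ k" by (simp only: of_nat_le_iff)
  have "oneway_cc (line_families d) (line_families d) (line_disj G) \<le> enat k"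
  proof (rule oneway_cc_le[OF T(1) \<open>card ?T \<le> 2 ^ k\<close>])
    show "line_disj G S S' = (\<lambda>W S'. W \<inter> \<Union>S' = {}) (\<Union>S \<inter> G) S'" for S S'
      by (auto simp: line_disj_def)
  qed
  then have "ereal_of_enat (oneway_cc (line_families d) (line_families d) (line_disj G)) \<le> ereal k"
    by (metis ereal_of_enat_le_iff ereal_of_enat_simps(1))
  also have "\<dots> \<le> ereal (13 * (real d * L))" using k(2) by simp
  finally show ?thesis by (simp only: L_def)
qed

lemma grid_point_Ints: "grid_point n ` A \<subseteq> \<int> \<times> \<int>"
  by (auto simp: grid_point_def)

text \<open>A linear lower bound for \<open>rand_cc\<close> and the upper bound for
  \<open>oneway_cc\<close> suffice, since
  \<open>rand_cc \<le> det_cc \<le> oneway_cc + 1\<close>.\<close>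

theorem theorem4:
  "\<exists>(c :: real) (C :: real) (K :: real). 0 < c \<and> 0 < C \<and>
     (\<forall>(d :: nat) (n :: nat). 1 \<le> d \<and> d \<le> n \<longrightarrow>
       (\<exists>G :: (real \<times> real) set. G \<subseteq> \<int> \<times> \<int> \<and> finite G \<and> card G = n \<and>
         (K \<le> real n / real d \<longrightarrow>
            ereal (c * (real d * log 2 (real n / real d)))
              \<le> ereal_of_enat (det_cc (line_families d) (line_families d) (line_disj G)) \<and>
            ereal_of_enat (det_cc (line_families d) (line_families d) (line_disj G))
              \<le> ereal (C * (real d * log 2 (real n / real d))) \<and>
            ereal (c * (real d * log 2 (real n / real d)))
              \<le> ereal_of_enat (oneway_cc (line_families d) (line_families d) (line_disj G)) \<and>
            ereal_of_enat (oneway_cc (line_families d) (line_families d) (line_disj G))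
              \<le> ereal (C * (real d * log 2 (real n / real d))) \<and>
            ereal (c * (real d * (log 2 (real n / real d) / log 2 (log 2 (real n / real d)))))
              \<le> ereal_of_enat (rand_cc (line_families d) (line_families d) (line_disj G)))))"
proof (rule exI[of _ "disj_rate / 8"], rule exI[of _ 14],
    rule exI[of _ "2 powr (4 + 64 / disj_rate)"], intro conjI allI impI)
  \<comment> \<open>The constant 14 is 13 plus room for Bob's announcing bit. The threshold ensures
    \<open>L \<ge> 4\<close>, for rounding \<open>k\<close>, and
    \<open>disj_rate * L \<ge> 64\<close>, for absorbing additive losses.\<close>
  show "0 < disj_rate / 8" using disj_rate_pos by simp
  show "(0::real) < 14" by simp
  fix d n :: nat
  assume dn: "1 \<le> d \<and> d \<le> n"
  define L where "L = log 2 (real n / real d)"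
  \<comment> \<open>Half of \<open>L\<close>, because each block costs \<open>4 ^ k\<close>
    points.\<close>
  define k where "k = nat \<lfloor>L / 2\<rfloor>"
  have ge1: "1 \<le> real n / real d" using dn by simp
  then have L0: "0 \<le> L" by (simp add: L_def)
  have "real k \<le> L / 2" using L0 unfolding k_def by linarith
  then have "2 powr (2 * real k) \<le> 2 powr L" by simp
  also have "2 powr L = real n / real d" using dn by (simp add: L_def)
  also have "2 powr (2 * real k) = 4 ^ k"
    by (simp add: powr_powr[symmetric] powr_realpow)
  finally have "real d * 4 ^ k \<le> real n" using dn by (simp add: field_simps)
  then have "real (d * 4 ^ k) \<le> real n" by simp
  then have "d * 4 ^ k \<le> n" by (simp only: of_nat_le_iff)
  then obtain G \<phi> \<psi> where G: "G \<subseteq> grid_point n ` ({..n} \<times> {..n})" "card G = n"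
    and \<phi>: "\<And>x. x \<subseteq> {..<d} \<times> {..<k} \<Longrightarrow> \<phi> x \<in> line_families d"
    and \<psi>: "\<And>y. y \<subseteq> {..<d} \<times> {..<k} \<Longrightarrow> \<psi> y \<in> line_families d"
    and disj: "\<And>x y. x \<subseteq> {..<d} \<times> {..<k} \<Longrightarrow> y \<subseteq> {..<d} \<times> {..<k} \<Longrightarrow> line_disj G (\<phi> x) (\<psi> y) \<longleftrightarrow> x \<inter> y = {}"
    by (rule grid_disjointness) blast
  let ?D = "det_cc (line_families d) (line_families d) (line_disj G)"
  let ?O = "oneway_cc (line_families d) (line_families d) (line_disj G)"
  let ?R = "rand_cc (line_families d) (line_families d) (line_disj G)"
  have bounds: "ereal (disj_rate / 8 * (real d * L)) \<le> ereal_of_enat ?D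
      \<and> ereal_of_enat ?D \<le> ereal (14 * (real d * L))
      \<and> ereal (disj_rate / 8 * (real d * L)) \<le> ereal_of_enat ?O
      \<and> ereal_of_enat ?O \<le> ereal (14 * (real d * L))
      \<and> ereal (disj_rate / 8 * (real d * (L / log 2 L))) \<le> ereal_of_enat ?R"
    if K: "2 powr (4 + 64 / disj_rate) \<le> real n / real d"
  proof -
    have "4 + 64 / disj_rate \<le> L"
      unfolding L_def using K ge1 by (subst le_log_iff) auto
    then have L4: "4 \<le> L" and "64 / disj_rate \<le> L"
      using disj_rate_pos by (smt (verit) divide_nonneg_pos)+
    then have "64 \<le> disj_rate * L"
      using disj_rate_pos by (simp add: field_simps)
    then have "64 * 1 \<le> (disj_rate * L) * real d"
      using dn by (intro mult_mono) auto
    then have rdL: "64 \<le> disj_rate * (real d * L)" by (simp add: algebra_simps)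
    have dL: "1 \<le> real d * L" using dn L4 mult_mono[of 1 "real d" 1 L] by simp
    \<comment> \<open>Rounding down loses less than 1, which is at most
      \<open>L / 4\<close>.\<close>
    have "L / 4 \<le> real k" using L4 unfolding k_def by linarith
    then have "disj_rate * (real d * (L / 4)) \<le> disj_rate * (real d * real k)"
      using disj_rate_pos by (intro mult_left_mono) auto
    \<comment> \<open>Half of \<open>disj_rate * d * L / 4\<close> is at least 8: it covers the loss
      7 and a reserve of 1 for passing from \<open>det_cc\<close> to
      \<open>oneway_cc\<close>.\<close>
    then have "disj_rate / 8 * (real d * L) + 1 \<le> disj_rate * card ({..<d} \<times> {..<k}) - 7"
      using rdL by (simp add: card_cartesian_product)
    then have "ereal (disj_rate / 8 * (real d * L) + 1) \<le> ereal (disj_rate * card ({..<d} \<times> {..<k}) - 7)"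
      by simp
    also have "\<dots> \<le> ereal_of_enat ?R"
      by (rule rand_cc_ge_disj[of _ \<phi> _ \<psi>]) (auto simp: \<phi> \<psi> disj)
    finally have R: "ereal (disj_rate / 8 * (real d * L) + 1) \<le> ereal_of_enat ?R" .
    also have "\<dots> \<le> ereal_of_enat ?D" using rand_cc_le_det_cc by simp
    finally have D: "ereal (disj_rate / 8 * (real d * L) + 1) \<le> ereal_of_enat ?D" .
    have DO: "ereal_of_enat ?D \<le> ereal_of_enat ?O + 1"
      using det_cc_le_oneway_cc[of "line_families d" "line_families d" "line_disj G"]
      by (metis ereal_of_enat_add ereal_of_enat_le_iff ereal_of_enat_simps(1) of_nat_1 one_enat_def one_ereal_def)
    have O: "ereal_of_enat ?O \<le> ereal (13 * (real d * L))"
    proof -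
      have "1 \<le> log 2 (real n / real d)" using L4 by (simp only: L_def)
      then show ?thesis unfolding L_def using dn G by (intro oneway_cc_line_disj_le) auto
    qed
    then obtain o' where o': "?O = enat o'" by (cases ?O) auto
    have oD: "ereal_of_enat ?D \<le> ereal (real o' + 1)"
      using DO by (simp add: o' one_ereal_def)
    \<comment> \<open>The linear bound implies the stated randomized one because
      \<open>log 2 L \<ge> 1\<close>.\<close>
    have "disj_rate / 8 * (real d * (L / log 2 L)) \<le> disj_rate / 8 * (real d * L)"
    proof -
      have "1 \<le> log 2 L" using L4 by (subst le_log_iff) auto
      then have "L / log 2 L \<le> L / 1" using L4 by (intro divide_left_mono) auto
      then show ?thesis using disj_rate_pos by (intro mult_left_mono) auto
    qed
    then have "ereal (disj_rate / 8 * (real d * (L / log 2 L))) \<le> ereal_of_enat ?R"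
      using R by (meson ereal_less_eq(3) add_increasing2 order.trans zero_le_one)
    moreover have "ereal (disj_rate / 8 * (real d * L)) \<le> ereal_of_enat ?D"
      using D by (meson ereal_less_eq(3) add_increasing2 order.refl order.trans zero_le_one)
    moreover have "disj_rate / 8 * (real d * L) + 1 \<le> real o' + 1"
      using order.trans[OF D oD] by simp
    moreover have "real o' \<le> 13 * (real d * L)" using O by (simp add: o')
    moreover from this have "ereal (real o' + 1) \<le> ereal (14 * (real d * L))" using dL by simp
    then have "ereal_of_enat ?D \<le> ereal (14 * (real d * L))" using oD by (rule order.trans[rotated])
    ultimately show ?thesis using dL by (simp add: o')
  qed
  have fin: "finite G" using G(1) by (rule finite_subset) simp
  have int: "G \<subseteq> \<int> \<times> \<int>" using G(1) grid_point_Ints by (rule order.trans)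
  show "\<exists>G :: (real \<times> real) set. G \<subseteq> \<int> \<times> \<int> \<and> finite G \<and> card G = n \<and>
         (2 powr (4 + 64 / disj_rate) \<le> real n / real d \<longrightarrow>
            ereal (disj_rate / 8 * (real d * log 2 (real n / real d)))
              \<le> ereal_of_enat (det_cc (line_families d) (line_families d) (line_disj G)) \<and>
            ereal_of_enat (det_cc (line_families d) (line_families d) (line_disj G))
              \<le> ereal (14 * (real d * log 2 (real n / real d))) \<and>
            ereal (disj_rate / 8 * (real d * log 2 (real n / real d)))
              \<le> ereal_of_enat (oneway_cc (line_families d) (line_families d) (line_disj G)) \<and>
            ereal_of_enat (oneway_cc (line_families d) (line_families d) (line_disj G))
              \<le> ereal (14 * (real d * log 2 (real n / real d))) \<and>
            ereal (disj_rate / 8 * (real d * (log 2 (real n / real d) / log 2 (log 2 (real n / real d)))))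
              \<le> ereal_of_enat (rand_cc (line_families d) (line_families d) (line_disj G)))"
    using bounds int fin G(2) unfolding L_def by blast
qed

end
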